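(* Let $a,b\geq 2$ be multiplicatively independent integers. Let $X\subseteq[0,1]$ be a closed set with $T_aX\subseteq X$ that admits a non-atomic $T_a$-invariant Borel probability measure whose support is all of $X$. Let $Y\subsetneq[0,1]$ be a closed set with $T_bY\subseteq Y$. Then $X\cap Y$ has empty interior in $X$ (with respect to the relative topology of $X$).
   Context: For an integer $a\ge 2$, $T_a:[0,1]\to[0,1]$ is the map $T_a x = ax \bmod 1$. Integers $a,b\geq 2$ are multiplicatively independent if $a^m\neq b^n$ for all positive integers $m,n$. *)

theory Defs
  imports "HOL-Probability.Probability"
begin

definition times_map :: "nat \<Rightarrow> real \<Rightarrow> real" where
  "times_map a x = frac (real a * x)"

definition mult_independent :: "nat \<Rightarrow> nat \<Rightarrow> bool" where
  "mult_independent a b \<longleftrightarrow> (\<forall>m n. m > 0 \<longrightarrow> n > 0 \<longrightarrow> a ^ m \<noteq> b ^ n)"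

abbreviation unit_borel :: "real measure" where
  "unit_borel \<equiv> restrict_space borel {0..1}"

definition borel_prob_unit :: "real measure \<Rightarrow> bool" where
  "borel_prob_unit \<mu> \<longleftrightarrow> prob_space \<mu> \<and> sets \<mu> = sets unit_borel"

text \<open>The pushforward \<open>distr\<close> is only meaningful for measurable maps; see
  \<open>times_map_measurable\<close> below.\<close>

definition invariant_measure :: "('a \<Rightarrow> 'a) \<Rightarrow> 'a measure \<Rightarrow> bool" where
  "invariant_measure T \<mu> \<longleftrightarrow> distr \<mu> \<mu> T = \<mu>"

text \<open>Non-atomic means having no point masses. For finite Borel measures on a separable metric
  space this is the same as having no atoms in the general measure-theoretic sense.\<close>

definition nonatomic :: "'a measure \<Rightarrow> bool" where
  "nonatomic \<mu> \<longleftrightarrow> (\<forall>x \<in> space \<mu>. emeasure \<mu> {x} = 0)"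

text \<open>Sets open in the subspace \<open>space \<mu>\<close> are exactly the traces \<open>U \<inter> space \<mu>\<close> of open sets.\<close>

definition measure_support :: "'a::topological_space measure \<Rightarrow> 'a set" where
  "measure_support \<mu> =
     {x \<in> space \<mu>. \<forall>U. open U \<longrightarrow> x \<in> U \<longrightarrow> emeasure \<mu> (U \<inter> space \<mu>) > 0}"

lemma times_map_measurable: "times_map a \<in> measurable unit_borel unit_borel"
proof -
  have "times_map a = (\<lambda>x. real a * x - real_of_int \<lfloor>real a * x\<rfloor>)"
    by (auto simp: times_map_def frac_def)
  moreover have "(\<lambda>x. real a * x - real_of_int \<lfloor>real a * x\<rfloor>) \<in> borel_measurable borel"
    by measurable
  ultimately have "times_map a \<in> borel_measurable unit_borel"
    by (simp add: measurable_restrict_space1)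
  moreover have "times_map a x \<in> {0..1}" for x
    using frac_lt_1[of "real a * x"] by (simp add: times_map_def)
  ultimately show ?thesis
    by (intro measurable_restrict_space2) auto
qed

end

theory Submission
  imports Defs "HOL-Analysis.Kronecker_Approximation_Theorem" "HOL-Number_Theory.Residues"
begin

text \<open>
  Suppose \<open>X \<inter> U \<subseteq> Y\<close> for an open \<open>U\<close> meeting \<open>X\<close>, and let \<open>G\<close> be the closure of
  \<open>{(x, b\<^sup>n x)}\<close> in \<open>X \<times> \<real>/\<int>\<close>. It is invariant under \<open>T\<^sub>a \<times> T\<^sub>a\<close> and \<open>id \<times> T\<^sub>b\<close>, and its
  fibres over \<open>U\<close> lie in \<open>Y\<close>. If an invariant set \<open>D\<close> contains points \<open>(x', s)\<close> with \<open>x'\<close> near a given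
  \<open>x \<in> X\<close> and \<open>s \<noteq> 0\<close> small, it contains \<open>(a\<^sup>k x', b\<^sup>l a\<^sup>k s)\<close>; since the \<open>k\<close> that miss a given interval
  for every \<open>l\<close> have arbitrarily small density while, by invariance of the measure, some \<open>x\<close> returns
  to a given open set with positive frequency, the fibres of \<open>D\<close> over that open set have dense union.

  This is fed into a relative version of Boshernitzan's proof of Furstenberg's \<open>\<times>a, \<times>b\<close> theorem.
  As long as the fibres of an invariant \<open>W \<subseteq> G\<close> contain pairs of arbitrarily close distinct points,
  \<open>D\<close> may be the set of fibre differences of \<open>W\<close>, so \<open>{(x, w). (x, w), (x, w + 1/t) \<in> W}\<close> still has
  nonempty fibres over \<open>U\<close>; after \<open>t\<close> steps \<open>Y\<close> contains a progression with difference \<open>1/t\<close>, too dense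
  for its complement. Otherwise the fibres of \<open>W\<close> over some open set consist of rationals with a
  common denominator \<open>q\<close>; as \<open>X\<close> is perfect, these are limits of other points of \<open>G\<close>, so \<open>D\<close> may be the
  image of \<open>G\<close> under \<open>(x, w) \<mapsto> (x, q w)\<close>, and \<open>Y\<close> is everything by Baire's theorem.
\<close>

section \<open>Exponents hitting an interval\<close>

text \<open>About \<open>1/(2h)\<close> translates of the interval by multiples of \<open>\<alpha>\<close> are pairwise disjoint modulo 1 and
  are visited about equally often; this replaces equidistribution and is uniform in \<open>v\<close>.\<close>

lemma rotation_count:
  fixes \<alpha> h :: real
  assumes irr: "\<alpha> \<notin> \<rat>" and h: "0 < h" "h \<le> 1/4"
  obtains I :: nat where
    "\<And>v N. real (card {k. k < N \<and> (\<exists>n::int. real k * \<alpha> + n \<in> {v..v+h})}) \<le> 4 * h * (real N + I)"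
proof -
  \<comment> \<open>\<open>m\<close> windows of length \<open>2 * h\<close> fit side by side into a
    unit interval, and \<open>m\<close> is still at least \<open>1 / (4*h)\<close>, whence the
    factor \<open>4 * h\<close>.\<close>
  define m where "m = nat \<lfloor>1 / (2*h)\<rfloor>"
  have m_le: "real m \<le> 1 / (2*h)"
    using h by (simp add: m_def)
  have "real m \<ge> 1 / (2*h) - 1"
    unfolding m_def by linarith
  moreover have "1 / (2*h) - 1 \<ge> 1 / (4*h)"
    using h by (simp add: field_simps)
  ultimately have m_ge: "real m \<ge> 1 / (4*h)"
    by linarith
  have m2h: "2 * h * m \<le> 1"
    using m_le h by (simp add: field_simps)
  have "\<exists>i::nat. \<bar>frac (i * \<alpha>) - (2*h*j + h/2)\<bar> < h/2" if "j < m" for j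
  proof -
    have "2*h*(real j + 1) \<le> 2 * h * m"
      using that h by (intro mult_left_mono) auto
    hence "2*h*j + h/2 \<le> 1"
      using m2h h by (simp add: algebra_simps)
    thus ?thesis
      using Kronecker_approx_1_explicit[OF irr, of "2*h*j + h/2" "h/2"] h by (metis add_nonneg_nonneg
          divide_nonneg_nonneg half_gt_zero less_eq_real_def mult_nonneg_nonneg of_nat_0_le_iff zero_le_numeral)
  qed
  then obtain i :: "nat \<Rightarrow> nat" where i: "\<And>j. j < m \<Longrightarrow> \<bar>frac (i j * \<alpha>) - (2*h*j + h/2)\<bar> < h/2"
    by metis
  define I where "I = (\<Sum>j<m. i j)"
  have i_le: "i j \<le> I" if "j < m" for j
    unfolding I_def using that by (intro member_le_sum) auto
  show thesis
  proof
    fix v :: real and N :: nat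
    define A where "A = {k. k < N \<and> (\<exists>n::int. real k * \<alpha> + n \<in> {v..v+h})}"
    \<comment> \<open>Adding \<open>i j\<close> to a visit time \<open>k\<close> leads into the
      \<open>j\<close>-th window, since \<open>i j * \<alpha>\<close> lies modulo 1 between
      \<open>2*h*j\<close> and \<open>2*h*j + h\<close>.\<close>
    have loc: "\<exists>n::int. real (k + i j) * \<alpha> + n \<in> {v + 2*h*j <..< v + 2*h*j + 2*h}"
      if kj: "k \<in> A" "j < m" for k j
    proof -
      obtain n :: int where "real k * \<alpha> + n \<in> {v..v+h}"
        using kj unfolding A_def by blast
      moreover have "2*h*j < i j * \<alpha> - \<lfloor>i j * \<alpha>\<rfloor>" "i j * \<alpha> - \<lfloor>i j * \<alpha>\<rfloor> < 2*h*j + h"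
        using i[OF kj(2)] unfolding frac_def by linarith+
      moreover have "real (k + i j) * \<alpha> + of_int (n - \<lfloor>i j * \<alpha>\<rfloor>) = real k * \<alpha> + n + (i j * \<alpha> - \<lfloor>i j * \<alpha>\<rfloor>)"
        by (simp add: algebra_simps)
      ultimately have "real (k + i j) * \<alpha> + of_int (n - \<lfloor>i j * \<alpha>\<rfloor>) \<in> {v + 2*h*j <..< v + 2*h*j + 2*h}"
        by simp
      thus ?thesis by blast
    qed
    \<comment> \<open>All windows lie in a common unit interval, so a coincidence of times would
      produce an integer strictly between 0 and 1.\<close>
    have aux: False if jk: "k \<in> A" "k' \<in> A" "j < j'" "j' < m" "k + i j = k' + i j'" for k k' j j'
    proof -
      obtain n where n: "real (k + i j) * \<alpha> + of_int n \<in> {v + 2*h*j <..< v + 2*h*j + 2*h}"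
        using loc[of k j] jk by auto
      obtain n' where n': "real (k + i j) * \<alpha> + of_int n' \<in> {v + 2*h*j' <..< v + 2*h*j' + 2*h}"
        using loc[of k' j'] jk by auto
      have 1: "2*h*(real j + 1) \<le> 2*h*j'"
        using jk h by (intro mult_left_mono) auto
      have 2: "2*h*(real j' + 1) \<le> 2*h*m"
        using jk h by (intro mult_left_mono) auto
      have 3: "2 * h * real j \<ge> 0"
        using h by auto
      have "real_of_int (n' - n) > 0" "real_of_int (n' - n) < 1"
        using n n' 1 2 3 m2h unfolding of_int_diff greaterThanLessThan_iff distrib_left by linarith+
      thus False
        unfolding of_int_0_less_iff of_int_less_1_iff by linarith
    qed
    have inj: "inj_on (\<lambda>(j,k). k + i j) ({..<m} \<times> A)"
    proof (rule inj_onI, clarsimp)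
      fix j k j' k'
      assume "k \<in> A" "k' \<in> A" "j < m" "j' < m" "k + i j = k' + i j'"
      thus "j = j' \<and> k = k'"
        using aux[of k k' j j'] aux[of k' k j' j] by (cases j j' rule: linorder_cases) auto
    qed
    have "(\<lambda>(j,k). k + i j) ` ({..<m} \<times> A) \<subseteq> {..<N + I}"
      using i_le by (force simp: A_def intro: add_less_le_mono)
    hence "card ({..<m} \<times> A) \<le> card {..<N + I}"
      using card_inj_on_le[OF inj] by blast
    hence "m * card A \<le> N + I"
      by (simp add: card_cartesian_product)
    hence "real m * card A \<le> real N + I"
      by (metis of_nat_add of_nat_le_iff of_nat_mult)
    moreover have "1 / (4*h) * card A \<le> real m * card A"
      using m_ge by (intro mult_right_mono) auto
    ultimately have "1 / (4*h) * card A \<le> real N + I"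
      by linarith
    thus "card {k. k < N \<and> (\<exists>n::int. real k * \<alpha> + n \<in> {v..v+h})} \<le> 4 * h * (real N + I)"
      using h by (simp add: A_def field_simps)
  qed
qed

text \<open>The quantities reduced modulo \<open>B\<close> are the base-\<open>B\<close> digits of
  \<open>z\<close>. Each admissible cell of level \<open>M\<close> splits into \<open>B\<close>
  cells of the next level, one of which carries the forbidden digit.\<close>

lemma avoid_digit_cells:
  fixes B j :: nat
  assumes "j < B"
  shows "\<exists>I::int set. finite I \<and> card I \<le> (B - 1) ^ M \<and>
    (\<forall>z\<in>{0..<1::real}. (\<forall>i<M. \<lfloor>real B ^ (i+1) * z\<rfloor> mod B \<noteq> j) \<longrightarrow> \<lfloor>real B ^ M * z\<rfloor> \<in> I)"
proof (induction M)
  case 0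
  have "\<lfloor>z\<rfloor> = 0" if "z \<in> {0..<1::real}" for z
    using that by (simp add: floor_eq_iff)
  thus ?case
    by (intro exI[of _ "{0}"]) auto
next
  case (Suc M)
  then obtain I :: "int set" where I: "finite I" "card I \<le> (B - 1) ^ M"
    "\<And>z. z\<in>{0..<1::real} \<Longrightarrow> (\<And>i. i<M \<Longrightarrow> \<lfloor>real B ^ (i+1) * z\<rfloor> mod B \<noteq> j) \<Longrightarrow> \<lfloor>real B ^ M * z\<rfloor> \<in> I"
    by blast
  define D where "D = int ` ({..<B} - {j})"
  have D: "finite D" "card D = B - 1"
    using assms by (auto simp: D_def card_image)
  define J where "J = (\<lambda>(p,d). int B * p + d) ` (I \<times> D)"
  have "card J \<le> card (I \<times> D)"
    unfolding J_def using I(1) D(1) by (intro card_image_le) auto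
  also have "\<dots> \<le> (B - 1) ^ Suc M"
    using I(2) by (simp add: card_cartesian_product D)
  finally have "card J \<le> (B - 1) ^ Suc M" .
  moreover have "finite J"
    using I(1) D(1) by (auto simp: J_def)
  moreover have "\<lfloor>real B ^ Suc M * z\<rfloor> \<in> J"
    if z: "z \<in> {0..<1}" and dig: "\<forall>i<Suc M. \<lfloor>real B ^ (i+1) * z\<rfloor> mod B \<noteq> j" for z
  proof -
    let ?q = "\<lfloor>real B ^ Suc M * z\<rfloor>"
    have B: "B > 0" using assms by auto
    have "?q div B = \<lfloor>real B ^ Suc M * z / real_of_int B\<rfloor>"
      by (subst floor_divide_real_eq_div) auto
    also have "\<dots> = \<lfloor>real B ^ M * z\<rfloor>"
      using B by simp
    finally have "?q div B \<in> I"
      using I(3) z dig by auto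
    moreover have "?q mod B \<in> D"
    proof -
      have "?q mod B = int (nat (?q mod B))" "nat (?q mod B) < B"
        using B by (auto simp: nat_less_iff)
      moreover have "?q mod B \<noteq> j"
        using dig[rule_format, of M] by simp
      ultimately show ?thesis
        unfolding D_def by (metis DiffI imageI lessThan_iff singletonD)
    qed
    ultimately show ?thesis
      unfolding J_def by (intro image_eqI[of _ _ "(?q div B, ?q mod B)"]) auto
  qed
  ultimately show ?case by blast
qed

text \<open>If \<open>k\<close> misses the interval, the base-\<open>B\<close> expansion (\<open>B\<close> a power of \<open>b\<close>) of the mantissa of \<open>a\<^sup>k s\<close>
  avoids some fixed digit, so the mantissa lies in one of few cells. On the logarithmic scale
  the mantissas form an orbit of the rotation by \<open>log b a\<close>.\<close>

lemma few_exponents_miss_interval: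
  fixes a b :: nat and c \<eta> \<delta> :: real
  assumes a: "a \<ge> 1" and b: "b \<ge> 2" and irr: "log b a \<notin> \<rat>" and \<eta>: "\<eta> > 0" and \<delta>: "\<delta> > 0"
  obtains N0 :: nat where
    "\<And>N s. N \<ge> N0 \<Longrightarrow> 0 < s \<Longrightarrow> s * real a ^ N < 1 \<Longrightarrow>
      card {k. k < N \<and> \<not> (\<exists>(l::nat) (n::int). real b ^ l * (real a ^ k * s) + n \<in> {c<..<c+\<eta>})} < \<delta> * N"
proof -
  \<comment> \<open>A power of \<open>b\<close> above \<open>2 / \<eta>\<close> makes the target
    long enough to contain a full cell from \<open>j'/B\<close> to \<open>(j'+1)/B\<close>, wherever
    \<open>c\<close> lies.\<close>
  obtain m where "2 / \<eta> < real b ^ m"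
    using real_arch_pow[of b "2 / \<eta>"] b by auto
  define B where "B = b ^ Suc m"
  have "real b ^ m * 1 \<le> real B"
    using b unfolding B_def by (simp add: mult_le_cancel_right1)
  hence B2\<eta>: "2 / \<eta> < real B"
    using \<open>2 / \<eta> < real b ^ m\<close> by linarith
  have B: "B \<ge> 2"
    using b mult_le_mono[of 2 b 1 "b ^ m"] unfolding B_def by simp
  define j' where "j' = \<lfloor>c * B\<rfloor> + 1"
  have j': "c < j' / B" "(j' + 1) / B < c + \<eta>"
  proof -
    have "c * B < j'" "j' \<le> c * B + 1"
      unfolding j'_def by linarith+
    moreover have "2 < \<eta> * B"
      using B2\<eta> \<eta> by (simp add: field_simps)
    moreover have "(c + \<eta>) * B = c * B + \<eta> * B"
      by (simp add: algebra_simps)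
    ultimately have "c * B < j'" "j' + 1 < (c + \<eta>) * B"
      by linarith+
    thus "c < j' / B" "(j' + 1) / B < c + \<eta>"
      using B by (simp_all add: pos_less_divide_eq pos_divide_less_eq)
  qed
  define j where "j = nat (j' mod B)"
  have j: "j < B" "int j = j' mod B"
    using B by (auto simp: j_def nat_less_iff)
  \<comment> \<open>\<open>C\<close> bounds the derivative of \<open>log b\<close> to the right of
    \<open>1/b\<close>, so \<open>h = C / B ^ M\<close> will bound the logarithmic length of a cell
    of level \<open>M\<close>. At most \<open>(B-1) ^ M\<close> cells occur, which leads to the
    factor \<open>8 * C * q ^ M\<close>, small for large \<open>M\<close>.\<close>
  define C where "C = real b / ln b"
  have C: "C > 0"
    using b by (auto simp: C_def)
  define q where "q = 1 - 1 / real B"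
  have q: "0 \<le> q" "q < 1"
    using B by (auto simp: q_def)
  have "(\<lambda>M. 8 * C * q ^ M) \<longlonglongrightarrow> 8 * C * 0"
    by (intro tendsto_intros LIMSEQ_realpow_zero q)
  hence "eventually (\<lambda>M. 8 * C * q ^ M < \<delta>) sequentially"
    by (rule order_tendstoD(2)) (use \<delta> in simp)
  moreover have "(\<lambda>M. C * (1 / real B) ^ M) \<longlonglongrightarrow> C * 0"
    using B by (intro tendsto_intros LIMSEQ_realpow_zero) auto
  hence "eventually (\<lambda>M. C * (1 / real B) ^ M < 1/4) sequentially"
    by (rule order_tendstoD(2)) simp
  ultimately have "eventually (\<lambda>M. 8 * C * q ^ M < \<delta> \<and> C * (1 / real B) ^ M < 1/4) sequentially"
    by eventually_elim auto
  then obtain M where M: "8 * C * q ^ M < \<delta>" "C * (1 / real B) ^ M < 1/4"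
    using eventually_happens'[OF sequentially_bot] by blast
  define h where "h = C / real B ^ M"
  have h: "h > 0" "h \<le> 1/4"
    using M(2) C B by (auto simp: h_def power_divide)
  obtain I :: "int set" where I: "finite I" "card I \<le> (B - 1) ^ M"
    "\<And>z. z\<in>{0..<1::real} \<Longrightarrow> (\<And>i. i<M \<Longrightarrow> \<lfloor>real B ^ (i+1) * z\<rfloor> mod B \<noteq> j) \<Longrightarrow> \<lfloor>real B ^ M * z\<rfloor> \<in> I"
    using avoid_digit_cells[OF j(1), of M] by blast
  obtain R :: nat where R:
    "\<And>v N. real (card {k. k < N \<and> (\<exists>n::int. real k * log b a + n \<in> {v..v+h})}) \<le> 4 * h * (real N + R)"
    using rotation_count[OF irr h] by blast
  show thesis
  proof (rule that[of "Suc R"])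
    fix N :: nat and s :: real
    assume N: "N \<ge> Suc R" and s: "0 < s" "s * real a ^ N < 1"
    define A where "A = {k. k < N \<and> \<not> (\<exists>(l::nat) (n::int). real b ^ l * (real a ^ k * s) + n \<in> {c<..<c+\<eta>})}"
    \<comment> \<open>A cell may begin below \<open>1/b\<close> although mantissas do not; the
      maximum keeps the slope bound \<open>C\<close> valid.\<close>
    define v where "v = (\<lambda>p::int. log b (max (p / real B ^ M) (1 / b)) - log b s)"
    define E where "E = (\<lambda>p. {k. k < N \<and> (\<exists>n::int. real k * log b a + n \<in> {v p..v p+h})})"
    have "A \<subseteq> (\<Union>p\<in>I. E p)"
    proof
      fix k assume k: "k \<in> A"
      define y where "y = real a ^ k * s"
      have "real a ^ k \<le> real a ^ N"
        using k a by (intro power_increasing) (auto simp: A_def)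
      hence "y \<le> s * real a ^ N"
        using s unfolding y_def by (simp add: mult.commute)
      hence "y < 1"
        using s(2) by linarith
      moreover have "0 < y"
        using s a by (simp add: y_def)
      ultimately have y: "0 < y" "y < 1" by auto
      have "\<exists>l. real b ^ l * y \<ge> 1 / b"
        using real_arch_pow[of b "1 / (b * y)"] b y by (auto simp: field_simps intro: less_imp_le)
      \<comment> \<open>The least such exponent normalises \<open>y\<close> to a mantissa in
        \<open>[1/b, 1)\<close>.\<close>
      define l where "l = (LEAST l. real b ^ l * y \<ge> 1 / b)"
      have l1: "real b ^ l * y \<ge> 1 / b"
        unfolding l_def by (rule LeastI_ex) fact
      have l2: "real b ^ l * y < 1"
      proof (cases l)
        case 0
        thus ?thesis using y by simp
      next
        case (Suc l')
        hence "real b ^ l' * y < 1 / b"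
          using not_less_Least[of l' "\<lambda>l. real b ^ l * y \<ge> 1 / b"] by (simp add: l_def not_le)
        thus ?thesis using b Suc by (simp add: field_simps)
      qed
      define z where "z = real b ^ l * y"
      define p where "p = \<lfloor>real B ^ M * z\<rfloor>"
      have "p \<in> I"
        unfolding p_def
      proof (rule I(3))
        show "z \<in> {0..<1}"
          using l1 l2 y by (auto simp: z_def)
        fix i assume "i < M"
        show "\<lfloor>real B ^ (i+1) * z\<rfloor> mod B \<noteq> j"
        proof
          assume "\<lfloor>real B ^ (i+1) * z\<rfloor> mod B = j"
          hence "\<lfloor>real B ^ (i+1) * z\<rfloor> mod B = j' mod B"
            using j by simp
          \<comment> \<open>A digit equal to \<open>j\<close> places \<open>B ^ i * z\<close> modulo
            1 in the cell inside the target. As \<open>B\<close> is a power of \<open>b\<close>,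
            this makes \<open>k\<close> a hit, contrary to \<open>k \<in> A\<close>.\<close>
          then obtain u where u: "\<lfloor>real B ^ (i+1) * z\<rfloor> = j' + int B * u"
            by (metis mod_eqE mult.commute)
          have "of_int (j' + int B * u) \<le> real B ^ (i+1) * z" "real B ^ (i+1) * z < of_int (j' + int B * u) + 1"
            unfolding u[symmetric] by linarith+
          hence "j' / B \<le> real B ^ i * z + of_int (- u)" "real B ^ i * z + of_int (- u) < (j' + 1) / B"
            using B by (auto simp: field_simps)
          hence "real B ^ i * z + of_int (- u) \<in> {c<..<c+\<eta>}"
            using j' by auto
          moreover have "real B ^ i * z = real b ^ (Suc m * i + l) * (real a ^ k * s)"
            by (simp only: B_def z_def y_def power_add power_mult of_nat_power mult.assoc)
          ultimately have "real b ^ (Suc m * i + l) * (real a ^ k * s) + of_int (- u) \<in> {c<..<c+\<eta>}"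
            by simp
          thus False
            using k unfolding A_def by blast
        qed
      qed
      moreover have "k \<in> E p"
      proof -
        let ?x = "max (p / real B ^ M) (1 / b)"
        have BM: "real B ^ M > 0" using B by auto
        have "real_of_int p \<le> real B ^ M * z" "real B ^ M * z < p + 1"
          unfolding p_def by linarith+
        hence pz: "p / real B ^ M \<le> z" "z \<le> p / real B ^ M + 1 / real B ^ M"
          using BM by (auto simp: field_simps)
        have xb: "1 / b \<le> ?x" "1 / b > 0"
          using b by auto
        have x: "?x > 0" "?x \<le> z" "z \<le> ?x + 1 / real B ^ M"
          using l1 pz xb by (auto simp: z_def less_max_iff_disj)
        have "1 / ?x \<le> 1 / (1 / b)"
          using xb x(1) by (intro divide_left_mono mult_pos_pos) simp_all
        hence x': "1 / ?x \<le> b" by simp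
        \<comment> \<open>Modulo 1 this is the rotation by \<open>log b a\<close>, translated by
          \<open>log b s\<close>; \<open>l\<close> becomes the integer required in
          \<open>E p\<close>.\<close>
        have logz: "log b z = l + real k * log b a + log b s"
          using a b s by (simp add: z_def y_def log_mult log_nat_power)
        have "log b ?x \<le> log b z"
          using x b by (subst log_le_cancel_iff) auto
        moreover have "log b z \<le> log b ?x + h"
        proof -
          have "log b z - log b ?x = ln (z / ?x) / ln b"
            using x less_le_trans[OF x(1,2)] by (simp add: log_def ln_div diff_divide_distrib)
          also have "\<dots> \<le> (z / ?x - 1) / ln b"
            using x b by (intro divide_right_mono ln_le_minus_one) auto
          also have "\<dots> \<le> (1 / real B ^ M * b) / ln b"
          proof (rule divide_right_mono)
            have "z / ?x - 1 = (z - ?x) * (1 / ?x)"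
              using x by (simp add: field_simps)
            also have "\<dots> \<le> 1 / real B ^ M * b"
              using x x' BM by (intro mult_mono) auto
            finally show "z / ?x - 1 \<le> 1 / real B ^ M * b" .
          qed (use b in auto)
          also have "\<dots> = h"
            by (simp add: h_def C_def)
          finally show ?thesis by simp
        qed
        ultimately have "real k * log b a + of_int (int l) \<in> {v p..v p+h}"
          unfolding v_def logz by auto
        thus ?thesis
          using k unfolding E_def A_def by blast
      qed
      ultimately show "k \<in> (\<Union>p\<in>I. E p)" by blast
    qed
    moreover have finE: "finite (E p)" for p
      by (simp add: E_def)
    ultimately have "card A \<le> card (\<Union>p\<in>I. E p)"
      using I(1) by (intro card_mono) auto
    also have "\<dots> \<le> (\<Sum>p\<in>I. card (E p))"
      using I(1) by (rule card_UN_le)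
    finally have "real (card A) \<le> (\<Sum>p\<in>I. real (card (E p)))"
      by (metis of_nat_le_iff of_nat_sum)
    also have "\<dots> \<le> (\<Sum>p\<in>I. 4 * h * (real N + R))"
      unfolding E_def by (intro sum_mono R)
    also have "\<dots> = card I * (4 * h * (real N + R))"
      by simp
    also have "\<dots> \<le> real ((B - 1) ^ M) * (4 * h * (2 * real N))"
      using I(2) h N by (intro mult_mono) (auto simp del: of_nat_power)
    also have "\<dots> = 8 * C * q ^ M * N"
    proof -
      have "q = real (B - 1) / real B"
        using B by (simp add: q_def field_simps of_nat_diff)
      thus ?thesis
        by (simp add: h_def power_divide)
    qed
    also have "\<dots> < \<delta> * N"
      using M(1) N by (intro mult_strict_right_mono) auto
    finally show "card {k. k < N \<and> \<not> (\<exists>(l::nat) (n::int). real b ^ l * (real a ^ k * s) + n \<in> {c<..<c+\<eta>})} < \<delta> * N"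
      by (simp add: A_def)
  qed
qed

section \<open>Sets invariant under \<open>T\<^sub>a \<times> T\<^sub>a\<close> and \<open>id \<times> T\<^sub>b\<close>\<close>

text \<open>Subsets of the torus and of the circle are represented by their \<open>\<int>\<close>-periodic lifts, on which
  \<open>T\<^sub>a\<close> is multiplication by \<open>a\<close>.\<close>

definition skew_invariant :: "nat \<Rightarrow> nat \<Rightarrow> (real \<times> real) set \<Rightarrow> bool" where
  "skew_invariant a b D \<longleftrightarrow> (\<forall>x s. (x, s) \<in> D \<longrightarrow>
     (real a * x, real a * s) \<in> D \<and> (x, real b * s) \<in> D \<and>
     (\<forall>n::int. (x + n, s) \<in> D \<and> (x, s + n) \<in> D))"

lemma skew_invariantD:
  assumes "skew_invariant a b D" "(x, s) \<in> D"
  shows "(real a * x, real a * s) \<in> D" "(x, real b * s) \<in> D"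
    "(x + of_int n, s) \<in> D" "(x, s + of_int n) \<in> D"
  using assms unfolding skew_invariant_def by blast+

lemma skew_invariant_powers:
  assumes "skew_invariant a b D" "(x, s) \<in> D"
  shows "(real a ^ k * x, real b ^ l * (real a ^ k * s)) \<in> D"
proof -
  have "(real a ^ k * x, real a ^ k * s) \<in> D"
    by (induction k) (use assms skew_invariantD(1)[OF assms(1)] in \<open>auto simp: mult.assoc\<close>)
  thus ?thesis
    by (induction l) (use skew_invariantD(2)[OF assms(1)] in \<open>auto simp: mult.assoc\<close>)
qed

lemma skew_invariant_closure:
  assumes "skew_invariant a b D"
  shows "skew_invariant a b (closure D)"
proof -
  have *: "f p \<in> closure D" if "continuous_on UNIV f" "\<And>p. p \<in> D \<Longrightarrow> f p \<in> D" "p \<in> closure D"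
    for f :: "real \<times> real \<Rightarrow> real \<times> real" and p
  proof -
    have "f ` closure D \<subseteq> closure D"
      using that(1,2) closure_subset[of D]
      by (intro image_closure_subset) (auto intro: continuous_on_subset)
    thus ?thesis using that(3) by blast
  qed
  show ?thesis
    unfolding skew_invariant_def
  proof (intro allI impI conjI)
    fix x s :: real and n :: int assume xs: "(x, s) \<in> closure D"
    note skew = skew_invariantD[OF assms]
    show "(real a * x, real a * s) \<in> closure D"
      using *[OF _ _ xs, of "\<lambda>p. (real a * fst p, real a * snd p)"] skew(1)
      by (simp add: continuous_intros split_paired_all)
    show "(x, real b * s) \<in> closure D"
      using *[OF _ _ xs, of "\<lambda>p. (fst p, real b * snd p)"] skew(2)
      by (simp add: continuous_intros split_paired_all)
    show "(x + n, s) \<in> closure D"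
      using *[OF _ _ xs, of "\<lambda>p. (fst p + n, snd p)"] skew(3)
      by (simp add: continuous_intros split_paired_all)
    show "(x, s + n) \<in> closure D"
      using *[OF _ _ xs, of "\<lambda>p. (fst p, snd p + n)"] skew(4)
      by (simp add: continuous_intros split_paired_all)
  qed
qed

section \<open>Recurrence and density of fibres\<close>

definition return_times :: "nat \<Rightarrow> real set \<Rightarrow> real \<Rightarrow> nat set" where
  "return_times a V x = {k. \<exists>n::int. real a ^ k * x + n \<in> V}"

text \<open>The frequency \<open>\<delta>\<close> is fixed, but the point may change with
  \<open>N\<close>. In this finite-time form the property follows from invariance of a measure by
  averaging.\<close>

definition recurrent :: "nat \<Rightarrow> real set \<Rightarrow> real set \<Rightarrow> bool" where
  "recurrent a P V \<longleftrightarrow>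
     (\<exists>\<delta>>0. \<forall>N. \<exists>x\<in>V \<inter> P. \<delta> * real N \<le> real (card ({..<N} \<inter> return_times a V x)))"

text \<open>Before time \<open>N\<close> some \<open>x\<close> makes at least
  \<open>\<delta> * N\<close> returns, while fewer than \<open>\<delta> * N\<close> exponents miss
  the target, so some return time hits it. The point of \<open>D\<close> must be close enough to
  \<open>x\<close> to share these returns.\<close>

lemma fibres_dense:
  fixes a b :: nat and c \<eta> :: real
  assumes a: "a \<ge> 1" and b: "b \<ge> 2" and irr: "log b a \<notin> \<rat>"
    and V: "open V" and rec: "recurrent a P V" and D: "skew_invariant a b D"
    and near: "\<And>x e. x \<in> V \<inter> P \<Longrightarrow> e > 0 \<Longrightarrow> \<exists>x' s. (x', s) \<in> D \<and> \<bar>x' - x\<bar> < e \<and> s \<noteq> 0 \<and> \<bar>s\<bar> < e"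
    and \<eta>: "\<eta> > 0"
  shows "\<exists>x\<in>V. \<exists>s\<in>{c<..<c+\<eta>}. (x, s) \<in> D"
proof -
  obtain \<delta> where \<delta>: "\<delta> > 0" and rec': "\<And>N. \<exists>x\<in>V \<inter> P. \<delta> * real N \<le> real (card ({..<N} \<inter> return_times a V x))"
    using rec unfolding recurrent_def by blast
  obtain N1 where N1: "\<And>N s. N \<ge> N1 \<Longrightarrow> 0 < s \<Longrightarrow> s * real a ^ N < 1 \<Longrightarrow>
      card {k. k < N \<and> \<not> (\<exists>(l::nat) (n::int). real b ^ l * (real a ^ k * s) + n \<in> {c<..<c+\<eta>})} < \<delta> * N"
    using few_exponents_miss_interval[OF a b irr \<eta> \<delta>] by blast
  \<comment> \<open>For negative \<open>s\<close> the target is reflected to the interval from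
    \<open>-c-\<eta>\<close> to \<open>-c\<close>, and the count is applied to the absolute
    value.\<close>
  obtain N2 where N2: "\<And>N s. N \<ge> N2 \<Longrightarrow> 0 < s \<Longrightarrow> s * real a ^ N < 1 \<Longrightarrow>
      card {k. k < N \<and> \<not> (\<exists>(l::nat) (n::int). real b ^ l * (real a ^ k * s) + n \<in> {-c-\<eta><..<-c-\<eta>+\<eta>})} < \<delta> * N"
    using few_exponents_miss_interval[OF a b irr \<eta> \<delta>] by blast
  define N where "N = max N1 N2"
  obtain x where x: "x \<in> V \<inter> P" "\<delta> * real N \<le> real (card ({..<N} \<inter> return_times a V x))"
    using rec' by blast
  define K where "K = {..<N} \<inter> return_times a V x"
  have "\<forall>k\<in>K. \<exists>n::int. real a ^ k * x + n \<in> V"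
    by (auto simp: K_def return_times_def)
  then obtain n :: "nat \<Rightarrow> int" where n: "\<And>k. k \<in> K \<Longrightarrow> real a ^ k * x + n k \<in> V"
    by metis
  \<comment> \<open>On this neighbourhood of \<open>x\<close> all finitely many returns in
    \<open>K\<close> persist, with the same integer shifts.\<close>
  define U where "U = (\<Inter>k\<in>K. (\<lambda>y. real a ^ k * y + n k) -` V)"
  have "open U"
    unfolding U_def K_def
    by (intro open_INT ballI open_vimage V continuous_intros) auto
  moreover have "x \<in> U"
    using n by (auto simp: U_def)
  ultimately obtain e where e: "e > 0" "ball x e \<subseteq> U"
    by (meson open_contains_ball)
  have aN: "real a ^ N > 0"
    using a by simp
  obtain x' s where s: "(x', s) \<in> D" "\<bar>x' - x\<bar> < min e (1 / real a ^ N)" "s \<noteq> 0" "\<bar>s\<bar> < min e (1 / real a ^ N)"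
    using near[OF x(1), of "min e (1 / real a ^ N)"] e(1) aN by auto
  have small: "\<bar>s\<bar> * real a ^ N < 1"
    using s(4) aN by (simp add: field_simps)
  have x'U: "x' \<in> U"
    using s(2) e(2) by (auto simp: dist_real_def abs_minus_commute)
  have hit: "\<exists>k\<in>K. \<exists>(l::nat) (m::int). real b ^ l * (real a ^ k * \<bar>s\<bar>) + m \<in> {d<..<d+\<eta>}"
    if "card {k. k < N \<and> \<not> (\<exists>(l::nat) (m::int). real b ^ l * (real a ^ k * \<bar>s\<bar>) + m \<in> {d<..<d+\<eta>})} < \<delta> * N" for d
  proof (rule ccontr)
    let ?A = "{k. k < N \<and> \<not> (\<exists>(l::nat) (m::int). real b ^ l * (real a ^ k * \<bar>s\<bar>) + m \<in> {d<..<d+\<eta>})}"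
    assume "\<not> ?thesis"
    hence "K \<subseteq> ?A"
      unfolding K_def by blast
    hence "card K \<le> card ?A"
      by (intro card_mono) auto
    thus False
      using that x(2) unfolding K_def by linarith
  qed
  have "\<exists>k\<in>K. \<exists>(l::nat) (m::int). real b ^ l * (real a ^ k * s) + m \<in> {c<..<c+\<eta>}"
  proof (cases "s > 0")
    case True
    have "\<exists>k\<in>K. \<exists>(l::nat) (m::int). real b ^ l * (real a ^ k * \<bar>s\<bar>) + m \<in> {c<..<c+\<eta>}"
      using True small by (intro hit N1) (auto simp: N_def)
    thus ?thesis
      using True by simp
  next
    case False
    have "\<exists>k\<in>K. \<exists>(l::nat) (m::int). real b ^ l * (real a ^ k * \<bar>s\<bar>) + m \<in> {-c-\<eta><..<-c-\<eta>+\<eta>}"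
      using s(3) small by (intro hit N2) (auto simp: N_def)
    then obtain k l and m :: int
      where k: "k \<in> K" "real b ^ l * (real a ^ k * \<bar>s\<bar>) + m \<in> {-c-\<eta><..<-c-\<eta>+\<eta>}"
      by blast
    have "real b ^ l * (real a ^ k * s) + of_int (- m) \<in> {c<..<c+\<eta>}"
      using k(2) False by auto
    thus ?thesis
      using k(1) by blast
  qed
  then obtain k l and m :: int where k: "k \<in> K" "real b ^ l * (real a ^ k * s) + m \<in> {c<..<c+\<eta>}"
    by blast
  have "(real a ^ k * x' + n k, real b ^ l * (real a ^ k * s) + m) \<in> D"
    by (intro skew_invariantD(3,4)[OF D] skew_invariant_powers D s(1))
  moreover have "real a ^ k * x' + n k \<in> V"
    using x'U k(1) by (auto simp: U_def)
  ultimately show ?thesis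
    using k(2) by blast
qed

text \<open>Differences within fibres form an invariant set, to which \<open>fibres_dense\<close>
  applies over shrinking neighbourhoods of \<open>x\<close>. This gives pairs in \<open>W\<close>
  with differences tending to \<open>c\<close>; compactness modulo 1 and closedness of
  \<open>W\<close> yield a pair over \<open>x\<close> itself.\<close>

lemma fibre_differences:
  fixes a b :: nat and c :: real
  assumes a: "a \<ge> 1" and b: "b \<ge> 2" and irr: "log b a \<notin> \<rat>"
    and U: "open U" and rec: "\<And>V. open V \<Longrightarrow> V \<subseteq> U \<Longrightarrow> V \<inter> P \<noteq> {} \<Longrightarrow> recurrent a P V"
    and W: "skew_invariant a b W" "closed W"
    and near: "\<And>x e. x \<in> U \<inter> P \<Longrightarrow> e > 0 \<Longrightarrow>
      \<exists>x' w w'. (x', w) \<in> W \<and> (x', w') \<in> W \<and> \<bar>x' - x\<bar> < e \<and> w \<noteq> w' \<and> \<bar>w - w'\<bar> < e"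
    and x: "x \<in> U \<inter> P"
  shows "\<exists>w. (x, w) \<in> W \<and> (x, w + c) \<in> W"
proof -
  define D where "D = {(x, w' - w) | x w w'. (x, w) \<in> W \<and> (x, w') \<in> W}"
  have D: "skew_invariant a b D"
    unfolding skew_invariant_def
  proof (intro allI impI)
    fix x s assume "(x, s) \<in> D"
    then obtain w w' where w: "(x, w) \<in> W" "(x, w') \<in> W" "s = w' - w"
      unfolding D_def by blast
    have DI: "(y, v' - v) \<in> D" if "(y, v) \<in> W" "(y, v') \<in> W" for y v v'
      using that unfolding D_def by blast
    note W' = skew_invariantD[OF W(1) w(1)] skew_invariantD[OF W(1) w(2)]
    show "(real a * x, real a * s) \<in> D \<and> (x, real b * s) \<in> D \<and>
     (\<forall>n::int. (x + n, s) \<in> D \<and> (x, s + n) \<in> D)"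
      using DI[OF W'(1) W'(5)] DI[OF W'(2) W'(6)] DI[OF W'(3) W'(7)] DI[OF w(1) W'(8)]
      unfolding w(3) by (simp add: right_diff_distrib add_diff_eq diff_add_eq)
  qed
  have "\<exists>y w s. (y, w) \<in> W \<and> (y, w + s) \<in> W \<and> w \<in> {0..1} \<and> \<bar>y - x\<bar> < 1 / Suc n \<and> \<bar>s - c\<bar> < 1 / Suc n" for n :: nat
  proof -
    define V where "V = U \<inter> ball x (1 / Suc n)"
    have "\<exists>y\<in>V. \<exists>s\<in>{c<..<c + 1 / Suc n}. (y, s) \<in> D"
    proof (rule fibres_dense[OF a b irr _ _ D])
      show "open V"
        using U by (auto simp: V_def)
      moreover have "x \<in> V \<inter> P"
        using x by (auto simp: V_def)
      ultimately show "recurrent a P V"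
        by (intro rec) (auto simp: V_def)
      show "\<exists>x' s. (x', s) \<in> D \<and> \<bar>x' - y\<bar> < e \<and> s \<noteq> 0 \<and> \<bar>s\<bar> < e" if y: "y \<in> V \<inter> P" and e: "e > 0" for y e
      proof -
        obtain x' w w' where "(x', w) \<in> W" "(x', w') \<in> W" "\<bar>x' - y\<bar> < e" "w \<noteq> w'" "\<bar>w - w'\<bar> < e"
          using near[of y e] y e by (auto simp: V_def)
        thus ?thesis
          by (intro exI[of _ x'] exI[of _ "w - w'"]) (auto simp: D_def)
      qed
    qed auto
    then obtain y s where ys: "y \<in> V" "s \<in> {c<..<c + 1 / Suc n}" "(y, s) \<in> D"
      by blast
    then obtain w where w: "(y, w) \<in> W" "(y, w + s) \<in> W"
      unfolding D_def by auto
    have "(y, w + of_int (- \<lfloor>w\<rfloor>)) \<in> W" "(y, w + s + of_int (- \<lfloor>w\<rfloor>)) \<in> W"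
      using skew_invariantD(4)[OF W(1)] w by blast+
    hence "(y, frac w) \<in> W" "(y, frac w + s) \<in> W"
      by (auto simp: frac_def algebra_simps)
    moreover have "frac w \<in> {0..1}"
      using frac_ge_0[of w] frac_lt_1[of w] by auto
    ultimately show ?thesis
      using ys by (intro exI[of _ y] exI[of _ "frac w"] exI[of _ s])
        (auto simp: V_def dist_real_def abs_minus_commute)
  qed
  then obtain y w s where W': "\<And>n. (y n, w n) \<in> W" "\<And>n. (y n, w n + s n) \<in> W"
    and w01: "\<And>n. w n \<in> {0..1}"
    and lim: "\<And>n. \<bar>y n - x\<bar> < 1 / Suc n" "\<And>n. \<bar>s n - c\<bar> < 1 / Suc n"
    by metis
  have y: "y \<longlonglongrightarrow> x" and s: "s \<longlonglongrightarrow> c"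
    by (rule LIM_zero_cancel, rule LIMSEQ_norm_0, use lim in simp)+
  obtain l r where l: "strict_mono (r :: nat \<Rightarrow> nat)" "(w \<circ> r) \<longlonglongrightarrow> l"
    using w01 compact_Icc[of "0::real" 1] unfolding compact_def by metis
  have yr: "(y \<circ> r) \<longlonglongrightarrow> x" and sr: "(s \<circ> r) \<longlonglongrightarrow> c"
    using y s l(1) LIMSEQ_subseq_LIMSEQ by blast+
  have "(\<lambda>n. ((y \<circ> r) n, (w \<circ> r) n)) \<longlonglongrightarrow> (x, l)"
    by (intro tendsto_Pair yr l)
  hence "(x, l) \<in> W"
    by (rule closed_sequentially[OF W(2), rotated]) (use W' in auto)
  moreover have "(\<lambda>n. ((y \<circ> r) n, (w \<circ> r) n + (s \<circ> r) n)) \<longlonglongrightarrow> (x, l + c)"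
    by (intro tendsto_Pair tendsto_add yr sr l)
  hence "(x, l + c) \<in> W"
    by (rule closed_sequentially[OF W(2), rotated]) (use W' in auto)
  ultimately show ?thesis
    by blast
qed

text \<open>By the pigeonhole principle two of the points \<open>b\<^sup>j w\<close> agree modulo 1. The denominator depends
  only on \<open>b\<close> and \<open>e\<close>.\<close>

lemma separated_imp_rational:
  fixes b :: nat and e :: real
  assumes b: "b \<ge> 2" and e: "e > 0"
  obtains q :: nat where "q > 0"
    "\<And>S w. (\<And>w. w \<in> S \<Longrightarrow> real b * w \<in> S) \<Longrightarrow> (\<And>w n. w \<in> S \<Longrightarrow> w + of_int n \<in> S) \<Longrightarrow>
      (\<And>w w'. w \<in> S \<Longrightarrow> w' \<in> S \<Longrightarrow> \<bar>w - w'\<bar> < e \<Longrightarrow> w = w') \<Longrightarrow> w \<in> S \<Longrightarrow> real q * w \<in> \<int>"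
proof -
  obtain J :: nat where J: "1 / J < e" "J > 0"
    using e by (metis nat_approx_posE of_nat_0_less_iff zero_less_Suc)
  \<comment> \<open>Every \<open>b ^ j - b ^ i\<close> with \<open>i < j \<le> J\<close> is positive
    and at most \<open>b ^ J\<close>, hence divides this factorial.\<close>
  define q :: nat where "q = fact (b ^ J)"
  show thesis
  proof
    show "q > 0" by (simp add: q_def)
    fix S w
    assume mult: "\<And>w. w \<in> S \<Longrightarrow> real b * w \<in> S" and shift: "\<And>w n. w \<in> S \<Longrightarrow> w + of_int n \<in> S"
      and sep: "\<And>w w'. w \<in> S \<Longrightarrow> w' \<in> S \<Longrightarrow> \<bar>w - w'\<bar> < e \<Longrightarrow> w = w'" and w: "w \<in> S"
    have "real b ^ j * w \<in> S" for j
      by (induction j) (use w mult in \<open>auto simp: mult.assoc\<close>)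
    hence frac_S: "frac (real b ^ j * w) \<in> S" for j
      using shift[of _ "- \<lfloor>real b ^ j * w\<rfloor>"] by (simp add: frac_def)
    have "(\<lambda>j. \<lfloor>J * frac (real b ^ j * w)\<rfloor>) ` {..J} \<subseteq> {0..<int J}"
      using J(2) frac_lt_1 by (auto simp: floor_less_iff mult_less_cancel_left1)
    hence "card ((\<lambda>j. \<lfloor>J * frac (real b ^ j * w)\<rfloor>) ` {..J}) \<le> card {0..<int J}"
      by (intro card_mono) auto
    hence "\<not> inj_on (\<lambda>j. \<lfloor>J * frac (real b ^ j * w)\<rfloor>) {..J}"
      by (auto dest: card_image)
    then obtain i j where ij: "i \<le> J" "j \<le> J" "i < j" "\<lfloor>J * frac (real b ^ i * w)\<rfloor> = \<lfloor>J * frac (real b ^ j * w)\<rfloor>"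
      unfolding inj_on_def by (metis atMost_iff linorder_neqE_nat)
    have "\<bar>J * frac (real b ^ i * w) - J * frac (real b ^ j * w)\<bar> < 1"
      using ij(4) by linarith
    hence "J * \<bar>frac (real b ^ i * w) - frac (real b ^ j * w)\<bar> < 1"
      by (simp add: abs_mult flip: right_diff_distrib)
    hence "\<bar>frac (real b ^ i * w) - frac (real b ^ j * w)\<bar> < 1 / J"
      using J(2) by (simp add: field_simps)
    hence "frac (real b ^ i * w) = frac (real b ^ j * w)"
      using J(1) by (intro sep frac_S) auto
    hence *: "real b ^ j * w - real b ^ i * w = of_int (\<lfloor>real b ^ j * w\<rfloor> - \<lfloor>real b ^ i * w\<rfloor>)"
      by (simp add: frac_def)
    have lt: "b ^ i < b ^ j" "b ^ j \<le> b ^ J"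
      using b ij by (auto intro: power_strict_increasing power_increasing)
    hence "(b ^ j - b ^ i) dvd q"
      unfolding q_def by (intro dvd_fact) auto
    then obtain d where "q = (b ^ j - b ^ i) * d" by blast
    hence qd: "real q = (real b ^ j - real b ^ i) * d"
      using lt by (simp add: of_nat_diff)
    have "real q * w = (real b ^ j * w - real b ^ i * w) * real d"
      unfolding qd by (simp add: algebra_simps)
    hence "real q * w = of_int (\<lfloor>real b ^ j * w\<rfloor> - \<lfloor>real b ^ i * w\<rfloor>) * real d"
      unfolding * .
    thus "real q * w \<in> \<int>"
      by simp
  qed
qed

lemma interior_finite_Union_closed_eq_empty:
  fixes F :: "'i \<Rightarrow> 'a::topological_space set"
  assumes "finite I" "\<And>i. i \<in> I \<Longrightarrow> closed (F i)" "\<And>i. i \<in> I \<Longrightarrow> interior (F i) = {}"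
  shows "interior (\<Union>i\<in>I. F i) = {}"
  using assms
proof (induction I rule: finite_induct)
  case (insert i I)
  have "interior (F i \<union> (\<Union>i\<in>I. F i)) = interior (F i)"
    by (rule interior_closed_Un_empty_interior) (use insert in auto)
  thus ?case
    using insert.prems by simp
qed auto

text \<open>The translates of \<open>Z\<close> by multiples of \<open>1/q\<close> cover the line, so \<open>Z\<close> has interior points, and
  multiplication by \<open>b\<^sup>n\<close> expands a small interval to one longer than 1.\<close>

lemma dense_multiple_imp_UNIV:
  fixes Z :: "real set" and b q :: nat
  assumes b: "b \<ge> 2" and q: "q > 0" and Z: "closed Z"
    and mult: "\<And>y. y \<in> Z \<Longrightarrow> real b * y \<in> Z" and shift: "\<And>y n. y \<in> Z \<Longrightarrow> y + of_int n \<in> Z"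
    and dense: "\<And>c e. e > 0 \<Longrightarrow> \<exists>y\<in>Z. \<exists>m::int. real q * y + m \<in> {c<..<c+e}"
  shows "Z = UNIV"
proof -
  define F where "F = (\<lambda>i::nat. (\<lambda>y. i / real q + y) ` Z)"
  have clF: "closed (F i)" for i
    unfolding F_def using Z by (rule closed_translation)
  have "x \<in> closure (\<Union>i<q. F i)" for x
    unfolding closure_approachable
  proof (intro allI impI)
    fix e :: real assume e: "e > 0"
    obtain y and m :: int where y: "y \<in> Z" "real q * y + m \<in> {q*x<..<q*x+q*e}"
      using dense[of "q*e" "q*x"] e q by auto
    have 1: "real q * (y + m / q) = real q * y + m"
      using q by (simp add: field_simps)
    have "real q * x < real q * (y + m / q)" "real q * (y + m / q) < real q * (x + e)"
      using y(2) unfolding 1 by (auto simp: algebra_simps)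
    hence near: "x < y + m / q" "y + m / q < x + e"
      using q by (auto simp: mult_less_cancel_left_pos)
    \<comment> \<open>Division with remainder splits the shift \<open>m / q\<close> into an integer
      shift and one of the finitely many shifts defining \<open>F\<close>.\<close>
    have "real_of_int m = real q * of_int (m div q) + of_int (m mod q)"
      by (metis mult_div_mod_eq of_int_add of_int_mult of_int_of_nat_eq)
    hence "y + m / q = nat (m mod q) / real q + (y + of_int (m div q))"
      using q by (simp add: field_simps)
    hence "y + m / q \<in> F (nat (m mod q))"
      unfolding F_def using shift[OF y(1)] by blast
    moreover have "nat (m mod q) < q"
      using q by (simp add: nat_less_iff)
    ultimately have "y + m / q \<in> (\<Union>i<q. F i)"
      by blast
    thus "\<exists>z\<in>\<Union>i<q. F i. dist z x < e"
      using near by (intro bexI[of _ "y + m / q"]) (auto simp: dist_real_def)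
  qed
  moreover have "closed (\<Union>i<q. F i)"
    using clF by (intro closed_UN) auto
  ultimately have "(\<Union>i<q. F i) = UNIV"
    by (metis UNIV_eq_I closure_closed)
  hence "\<not> (\<forall>i\<in>{..<q}. interior (F i) = {})"
    using interior_finite_Union_closed_eq_empty[of "{..<q}" F] clF by auto
  then obtain i where "interior (F i) \<noteq> {}" by blast
  hence "interior Z \<noteq> {}"
    unfolding F_def by (simp add: interior_translation)
  then obtain u e where u: "e > 0" "ball u e \<subseteq> Z"
    using mem_interior by blast
  have powZ: "real b ^ n * y \<in> Z" if "y \<in> Z" for n y
    by (induction n) (use that mult in \<open>auto simp: mult.assoc\<close>)
  obtain n where n: "1 / e < real b ^ n"
    using real_arch_pow[of b "1/e"] b by auto
  have "x \<in> Z" for x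
  proof -
    \<comment> \<open>The point \<open>x + m\<close> is within 1 of \<open>b ^ n * u\<close>, and
      \<open>b ^ n\<close> expands the ball of radius \<open>e\<close> to a radius above 1.\<close>
    define m where "m = \<lfloor>real b ^ n * u - x\<rfloor>"
    have bn: "real b ^ n > 0" using b by simp
    have "\<bar>x + m - real b ^ n * u\<bar> \<le> 1"
      unfolding m_def by linarith
    also have "1 < real b ^ n * e"
      using n u(1) by (simp add: field_simps)
    finally have "\<bar>(x + m) / real b ^ n - u\<bar> < e"
      using bn by (simp add: field_simps abs_less_iff)
    hence "(x + m) / real b ^ n \<in> Z"
      using u(2) by (auto simp: dist_real_def abs_minus_commute)
    hence "real b ^ n * ((x + m) / real b ^ n) \<in> Z"
      by (rule powZ)
    hence "x + m \<in> Z"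
      using b by simp
    thus "x \<in> Z"
      using shift[of "x + m" "- m"] by simp
  qed
  thus ?thesis by blast
qed

section \<open>The orbit graph and its fibres\<close>

definition orbit_graph :: "nat \<Rightarrow> real set \<Rightarrow> (real \<times> real) set" where
  "orbit_graph b P = {(x, real b ^ n * x + of_int k) | x n k. x \<in> P}"

lemma orbit_graphI: "x \<in> P \<Longrightarrow> (x, real b ^ n * x + of_int k) \<in> orbit_graph b P"
  unfolding orbit_graph_def by blast

text \<open>Multiplication by \<open>a\<close> commutes with multiplication by \<open>b ^ n\<close>,
  and all integer errors are absorbed into \<open>k\<close>.\<close>

lemma skew_invariant_orbit_graph:
  assumes "\<And>x. x \<in> P \<Longrightarrow> real a * x \<in> P" "\<And>x n. x \<in> P \<Longrightarrow> x + of_int n \<in> P"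
  shows "skew_invariant a b (orbit_graph b P)"
  unfolding skew_invariant_def
proof (intro allI impI conjI)
  fix x s and m :: int
  assume "(x, s) \<in> orbit_graph b P"
  then obtain n k where x: "x \<in> P" and s: "s = real b ^ n * x + of_int k"
    unfolding orbit_graph_def by blast
  show "(real a * x, real a * s) \<in> orbit_graph b P"
    using orbit_graphI[OF assms(1)[OF x], of b n "int a * k"] s by (simp add: algebra_simps)
  show "(x, real b * s) \<in> orbit_graph b P"
    using orbit_graphI[OF x, of b "Suc n" "int b * k"] s by (simp add: algebra_simps)
  show "(x + m, s) \<in> orbit_graph b P"
    using orbit_graphI[OF assms(2)[OF x], of m b n "k - int (b ^ n) * m"] s by (simp add: algebra_simps)
  show "(x, s + m) \<in> orbit_graph b P"
    using orbit_graphI[OF x, of b n "k + m"] s by (simp add: algebra_simps)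
qed

text \<open>Over \<open>V\<close> the graph lies in the closed set \<open>UNIV \<times> Z\<close>.
  Since \<open>V\<close> is open, points of the closure over \<open>V\<close> are limits of graph
  points over \<open>V\<close>.\<close>

lemma closure_orbit_graph_fibre:
  assumes mult: "\<And>y. y \<in> Z \<Longrightarrow> real b * y \<in> Z" and shift: "\<And>y n. y \<in> Z \<Longrightarrow> y + of_int n \<in> Z"
    and Z: "closed Z" and V: "open V" "V \<inter> P \<subseteq> Z"
    and x: "x \<in> V" and w: "(x, w) \<in> closure (orbit_graph b P)"
  shows "w \<in> Z"
proof -
  have "real b ^ n * y \<in> Z" if "y \<in> Z" for n y
    by (induction n) (use that mult in \<open>auto simp: mult.assoc\<close>)
  hence "(V \<times> UNIV) \<inter> orbit_graph b P \<subseteq> UNIV \<times> Z"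
    using V(2) shift unfolding orbit_graph_def by blast
  moreover have "closed ((UNIV :: real set) \<times> Z)"
    using Z by (intro closed_Times) auto
  ultimately have "closure ((V \<times> UNIV) \<inter> orbit_graph b P) \<subseteq> UNIV \<times> Z"
    by (rule closure_minimal)
  moreover have "(V \<times> UNIV) \<inter> closure (orbit_graph b P) \<subseteq> closure ((V \<times> UNIV) \<inter> orbit_graph b P)"
    using V(1) by (intro open_Int_closure_subset open_Times) auto
  ultimately show ?thesis
    using x w by blast
qed

text \<open>Multiplication by \<open>q\<close> sends the given fibre points to integers. Perfectness
  provides nearby graph points whose images, after subtracting that integer, are small and nonzero,
  so \<open>fibres_dense\<close> makes the multiples \<open>q * y\<close> with
  \<open>y \<in> Z\<close> dense modulo 1.\<close>

lemma rational_fibres_imp_UNIV: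
  fixes a b q :: nat
  assumes a: "a \<ge> 1" and b: "b \<ge> 2" and irr: "log b a \<notin> \<rat>"
    and P: "\<And>x. x \<in> P \<Longrightarrow> real a * x \<in> P" "\<And>x n. x \<in> P \<Longrightarrow> x + of_int n \<in> P"
    and perfect: "\<And>x e. x \<in> P \<Longrightarrow> e > 0 \<Longrightarrow> \<exists>y\<in>P. y \<noteq> x \<and> \<bar>y - x\<bar> < e"
    and Z: "\<And>y. y \<in> Z \<Longrightarrow> real b * y \<in> Z" "\<And>y n. y \<in> Z \<Longrightarrow> y + of_int n \<in> Z" "closed Z"
    and V: "open V" "V \<inter> P \<subseteq> Z" and rec: "recurrent a P V"
    and q: "q > 0"
    and fibre: "\<And>x. x \<in> V \<inter> P \<Longrightarrow> \<exists>w. (x, w) \<in> closure (orbit_graph b P) \<and> real q * w \<in> \<int>"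
  shows "Z = UNIV"
proof (rule dense_multiple_imp_UNIV[OF b q Z(3,1,2)])
  fix c e :: real assume e: "e > 0"
  define G where "G = orbit_graph b P"
  have G: "skew_invariant a b G"
    unfolding G_def using P by (rule skew_invariant_orbit_graph)
  define D where "D = {(x, real q * w + of_int m) | x w m. (x, w) \<in> G}"
  have DI: "(x, real q * w + of_int m) \<in> D" if "(x, w) \<in> G" for x w m
    using that unfolding D_def by blast
  have D: "skew_invariant a b D"
    unfolding skew_invariant_def
  proof (intro allI impI conjI)
    fix x s and n :: int
    assume "(x, s) \<in> D"
    then obtain w m where w: "(x, w) \<in> G" and s: "s = real q * w + of_int m"
      unfolding D_def by blast
    show "(real a * x, real a * s) \<in> D"
      using DI[OF skew_invariantD(1)[OF G w], of "int a * m"] s by (simp add: algebra_simps)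
    show "(x, real b * s) \<in> D"
      using DI[OF skew_invariantD(2)[OF G w], of "int b * m"] s by (simp add: algebra_simps)
    show "(x + n, s) \<in> D"
      using DI[OF skew_invariantD(3)[OF G w], of n m] s by simp
    show "(x, s + n) \<in> D"
      using DI[OF w, of "m + n"] s by (simp add: algebra_simps)
  qed
  have "\<exists>x\<in>V. \<exists>s\<in>{c<..<c+e}. (x, s) \<in> D"
  proof (rule fibres_dense[OF a b irr V(1) rec D _ e])
    fix x d :: real assume x: "x \<in> V \<inter> P" and d: "d > 0"
    obtain r where r: "(x, r) \<in> closure G" "real q * r \<in> \<int>"
      using fibre[OF x] unfolding G_def by blast
    obtain p :: int where p: "real q * r = p"
      using r(2) by (auto elim: Ints_cases)
    \<comment> \<open>The approximations below have error less than \<open>2 * d'\<close>, which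
      multiplication by \<open>q\<close> enlarges to \<open>d\<close>.\<close>
    define d' where "d' = d / real q / 2"
    have d': "d' > 0" "d' \<le> d / 2"
      using d q by (auto simp: d'_def field_simps)
    obtain z where "z \<in> G" "dist z (x, r) < d'"
      using r(1) d'(1) unfolding closure_approachable by blast
    then obtain x1 n and k :: int where x1: "x1 \<in> P" "dist (x1, real b ^ n * x1 + k) (x, r) < d'"
      unfolding G_def orbit_graph_def by blast
    have x1': "\<bar>x1 - x\<bar> < d'" "\<bar>real b ^ n * x1 + k - r\<bar> < d'"
      using dist_fst_le[of "(x1, real b ^ n * x1 + k)" "(x, r)"]
        dist_snd_le[of "(x1, real b ^ n * x1 + k)" "(x, r)"] x1(2)
      by (simp_all add: dist_real_def)
    have bn: "real b ^ n \<ge> 1"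
      using b by simp
    \<comment> \<open>The graph point over \<open>x1\<close> may hit \<open>r\<close> exactly. With
      the same \<open>n\<close> and \<open>k\<close> the point over \<open>x2\<close> then does not,
      because an affine map of slope \<open>b ^ n\<close> is injective.\<close>
    obtain x2 where x2: "x2 \<in> P" "x2 \<noteq> x1" "\<bar>x2 - x1\<bar> < d' / real b ^ n"
      using perfect[OF x1(1), of "d' / real b ^ n"] d'(1) b by auto
    have "real b ^ n * \<bar>x2 - x1\<bar> < d'"
      using x2(3) less_le_trans[OF zero_less_one bn] by (simp add: pos_less_divide_eq mult.commute)
    hence diff: "\<bar>real b ^ n * x2 - real b ^ n * x1\<bar> < d'"
      by (simp add: abs_mult flip: right_diff_distrib)
    have "1 * \<bar>x2 - x1\<bar> \<le> real b ^ n * \<bar>x2 - x1\<bar>"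
      using bn by (intro mult_right_mono) auto
    hence "\<bar>x2 - x1\<bar> < d'"
      using \<open>real b ^ n * \<bar>x2 - x1\<bar> < d'\<close> by simp
    hence x2': "\<bar>x2 - x\<bar> < 2 * d'" "\<bar>real b ^ n * x2 + k - r\<bar> < 2 * d'"
      using x1' diff by linarith+
    have "real b ^ n * x1 + k \<noteq> r \<or> real b ^ n * x2 + k \<noteq> r"
      using x2(2) b by auto
    then obtain y where y: "y \<in> P" "\<bar>y - x\<bar> < 2 * d'" "\<bar>real b ^ n * y + k - r\<bar> < 2 * d'" "real b ^ n * y + k \<noteq> r"
      using x1(1) x1' x2(1) x2' d'(1) by fastforce
    define s where "s = real q * (real b ^ n * y + k) + of_int (- p)"
    have s_eq: "s = real q * (real b ^ n * y + k - r)"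
      using p by (simp add: s_def algebra_simps)
    have "(y, s) \<in> D"
      unfolding s_def G_def by (intro DI) (simp add: G_def orbit_graphI y(1))
    moreover have "\<bar>y - x\<bar> < d"
      using y(2) d'(2) by linarith
    moreover have "s \<noteq> 0"
      using y(4) q unfolding s_eq by simp
    moreover have "\<bar>s\<bar> < d"
    proof -
      have "\<bar>s\<bar> < real q * (2 * d')"
        unfolding s_eq abs_mult using y(3) q by simp
      also have "\<dots> = d"
        using q by (simp add: d'_def)
      finally show ?thesis .
    qed
    ultimately show "\<exists>x' s. (x', s) \<in> D \<and> \<bar>x' - x\<bar> < d \<and> s \<noteq> 0 \<and> \<bar>s\<bar> < d"
      by blast
  qed
  then obtain x s where xs: "x \<in> V" "s \<in> {c<..<c+e}" "(x, s) \<in> D"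
    by blast
  then obtain w m where w: "(x, w) \<in> G" "s = real q * w + of_int m"
    unfolding D_def by blast
  have "w \<in> Z"
    using closure_orbit_graph_fibre[OF Z V xs(1)] w(1) closure_subset unfolding G_def by blast
  thus "\<exists>y\<in>Z. \<exists>m::int. real q * y + m \<in> {c<..<c+e}"
    using w(2) xs(2) by blast
qed

text \<open>Induction on \<open>j\<close>: \<open>W\<close> collects the starting points of
  progressions of \<open>j + 1\<close> terms in \<open>G\<close>. Two starting points in one fibre
  that differ by \<open>1/t\<close> combine their progressions into one with an additional
  term.\<close>

lemma progression_in_fibres:
  fixes a b t :: nat
  assumes a: "a \<ge> 1" and b: "b \<ge> 2" and irr: "log b a \<notin> \<rat>"
    and t: "t > 0" "[a = 1] (mod t)" "[b = 1] (mod t)"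
    and P: "\<And>x. x \<in> P \<Longrightarrow> real a * x \<in> P" "\<And>x n. x \<in> P \<Longrightarrow> x + of_int n \<in> P"
    and perfect: "\<And>x e. x \<in> P \<Longrightarrow> e > 0 \<Longrightarrow> \<exists>y\<in>P. y \<noteq> x \<and> \<bar>y - x\<bar> < e"
    and Z: "\<And>y. y \<in> Z \<Longrightarrow> real b * y \<in> Z" "\<And>y n. y \<in> Z \<Longrightarrow> y + of_int n \<in> Z" "closed Z" "Z \<noteq> UNIV"
    and U: "open U" "U \<inter> P \<subseteq> Z"
    and rec: "\<And>V. open V \<Longrightarrow> V \<subseteq> U \<Longrightarrow> V \<inter> P \<noteq> {} \<Longrightarrow> recurrent a P V"
    and x: "x \<in> U \<inter> P"
  shows "\<exists>w. \<forall>i\<le>j. (x, w + real i / real t) \<in> closure (orbit_graph b P)"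
  using x
proof (induction j arbitrary: x)
  case 0
  have "(x, real b ^ 0 * x + of_int 0) \<in> closure (orbit_graph b P)"
    using 0 orbit_graphI closure_subset by blast
  thus ?case by auto
next
  case (Suc j)
  define G where "G = closure (orbit_graph b P)"
  have G: "skew_invariant a b G"
    unfolding G_def using P by (intro skew_invariant_closure skew_invariant_orbit_graph)
  define W where "W = {(x, w). \<forall>i\<le>j. (x, w + real i / real t) \<in> G}"
  have W_iff: "(x, w) \<in> W \<longleftrightarrow> (\<forall>i\<le>j. (x, w + real i / real t) \<in> G)" for x w
    by (simp add: W_def)
  have W_nonempty: "\<exists>w. (x, w) \<in> W" if "x \<in> U \<inter> P" for x
    using Suc.IH[OF that] unfolding W_iff G_def .
  have "closed W"
  proof -
    have "W = (\<Inter>i\<in>{..j}. (\<lambda>p. (fst p, snd p + real i / real t)) -` G)"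
      by (auto simp: W_def)
    moreover have "closed G"
      by (simp add: G_def)
    ultimately show ?thesis
      by (auto intro!: closed_INT closed_vimage continuous_intros)
  qed
  \<comment> \<open>A factor congruent to 1 modulo \<open>t\<close> fixes \<open>i/t\<close> modulo
    1; this is what makes \<open>W\<close> invariant.\<close>
  have drift: "\<exists>m::int. real d * (w + real i / real t) = real d * w + real i / real t + m"
    if d: "[d = 1] (mod t)" for d i w
  proof -
    have "int t dvd int d - 1"
      using d by (simp add: cong_iff_dvd_diff flip: cong_int_iff)
    then obtain u where "int d - 1 = int t * u" by blast
    hence "int d = 1 + int t * u" by simp
    hence "real_of_int (int d) = real_of_int (1 + int t * u)"
      by (rule arg_cong)
    hence d': "real d = 1 + real t * of_int u"
      by (simp only: of_int_add of_int_mult of_int_of_nat_eq of_int_1)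
    have "real d * (real i / real t) = real i / real t + of_int (int i * u)"
      unfolding d' using t(1) by (simp add: field_simps)
    thus ?thesis
      by (intro exI[of _ "int i * u"]) (simp add: distrib_left)
  qed
  have W: "skew_invariant a b W"
    unfolding skew_invariant_def
  proof (intro allI impI conjI)
    fix x w and n :: int
    assume xw: "(x, w) \<in> W"
    hence xwi: "(x, w + real i / real t) \<in> G" if "i \<le> j" for i
      using that W_iff by blast
    show "(real a * x, real a * w) \<in> W"
      unfolding W_iff
    proof (intro allI impI)
      fix i assume "i \<le> j"
      obtain m :: int where m: "real a * (w + real i / real t) = real a * w + real i / real t + m"
        using drift[OF t(2)] by blast
      have "(real a * x, real a * w + real i / real t + m) \<in> G"
        using skew_invariantD(1)[OF G xwi[OF \<open>i \<le> j\<close>]] unfolding m .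
      thus "(real a * x, real a * w + real i / real t) \<in> G"
        using skew_invariantD(4)[OF G, of _ _ "- m"] by fastforce
    qed
    show "(x, real b * w) \<in> W"
      unfolding W_iff
    proof (intro allI impI)
      fix i assume "i \<le> j"
      obtain m :: int where m: "real b * (w + real i / real t) = real b * w + real i / real t + m"
        using drift[OF t(3)] by blast
      have "(x, real b * w + real i / real t + m) \<in> G"
        using skew_invariantD(2)[OF G xwi[OF \<open>i \<le> j\<close>]] unfolding m .
      thus "(x, real b * w + real i / real t) \<in> G"
        using skew_invariantD(4)[OF G, of _ _ "- m"] by fastforce
    qed
    show "(x + n, w) \<in> W"
      using skew_invariantD(3)[OF G] xwi unfolding W_iff by blast
    show "(x, w + n) \<in> W"
      using skew_invariantD(4)[OF G xwi, of _ n] unfolding W_iff by (simp add: add_ac)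
  qed
  have near: "\<exists>x' w w'. (x', w) \<in> W \<and> (x', w') \<in> W \<and> \<bar>x' - x\<bar> < e \<and> w \<noteq> w' \<and> \<bar>w - w'\<bar> < e"
    if x: "x \<in> U \<inter> P" and e: "e > 0" for x e
  proof (rule ccontr)
    \<comment> \<open>Failure at \<open>x\<close> and \<open>e\<close> makes the fibres of
      \<open>W\<close> over \<open>U \<inter> ball x e\<close> \<open>e\<close>-separated. They then
      consist of rationals with a common denominator, which would force
      \<open>Z = UNIV\<close>.\<close>
    assume contr: "\<not> ?thesis"
    define V where "V = U \<inter> ball x e"
    obtain q :: nat where q: "q > 0"
      "\<And>S w. (\<And>w. w \<in> S \<Longrightarrow> real b * w \<in> S) \<Longrightarrow> (\<And>w n. w \<in> S \<Longrightarrow> w + of_int n \<in> S) \<Longrightarrow>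
        (\<And>w w'. w \<in> S \<Longrightarrow> w' \<in> S \<Longrightarrow> \<bar>w - w'\<bar> < e \<Longrightarrow> w = w') \<Longrightarrow> w \<in> S \<Longrightarrow> real q * w \<in> \<int>"
      using separated_imp_rational[OF b e] by blast
    have V: "open V" "V \<inter> P \<subseteq> Z" "V \<subseteq> U" "x \<in> V \<inter> P"
      using U x e by (auto simp: V_def)
    have "Z = UNIV"
    proof (rule rational_fibres_imp_UNIV[OF a b irr P perfect Z(1-3) V(1,2) _ q(1)])
      show "recurrent a P V"
        using rec V by blast
      fix y assume y: "y \<in> V \<inter> P"
      then obtain w where w: "(y, w) \<in> W"
        using W_nonempty V(3) by blast
      have "real q * w \<in> \<int>"
      proof (rule q(2)[of "{w. (y, w) \<in> W}"])
        show "\<And>v. v \<in> {w. (y, w) \<in> W} \<Longrightarrow> real b * v \<in> {w. (y, w) \<in> W}"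
          using skew_invariantD(2)[OF W] by blast
        show "\<And>v n. v \<in> {w. (y, w) \<in> W} \<Longrightarrow> v + of_int n \<in> {w. (y, w) \<in> W}"
          using skew_invariantD(4)[OF W] by blast
        have "\<bar>y - x\<bar> < e"
          using y by (auto simp: V_def dist_real_def abs_minus_commute)
        thus "\<And>v v'. v \<in> {w. (y, w) \<in> W} \<Longrightarrow> v' \<in> {w. (y, w) \<in> W} \<Longrightarrow> \<bar>v - v'\<bar> < e \<Longrightarrow> v = v'"
          using contr by blast
      qed (use w in simp)
      moreover have "(y, w) \<in> G"
        using w[unfolded W_iff, rule_format, of 0] by simp
      ultimately show "\<exists>w. (y, w) \<in> closure (orbit_graph b P) \<and> real q * w \<in> \<int>"
        unfolding G_def by blast
    qed
    with Z(4) show False by blast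
  qed
  obtain w where w: "(x, w) \<in> W" "(x, w + 1 / real t) \<in> W"
    using fibre_differences[OF a b irr U(1) rec W \<open>closed W\<close> near Suc.prems, of "1 / real t"] by blast
  have "(x, w + real i / real t) \<in> G" if "i \<le> Suc j" for i
  proof (cases i)
    case 0
    thus ?thesis
      using w(1) unfolding W_iff by auto
  next
    case (Suc i')
    hence "(x, w + 1 / real t + real i' / real t) \<in> G"
      using that w(2) unfolding W_iff by auto
    thus ?thesis
      using Suc by (simp add: add_divide_distrib add_ac)
  qed
  thus ?case
    unfolding G_def by blast
qed

text \<open>Modulo 1, \<open>t\<close> consecutive terms with step \<open>1/t\<close> meet every
  half-open interval of length \<open>1/t\<close>, in particular the gap of
  \<open>Z\<close>.\<close>

lemma no_common_open_part:
  fixes a b t :: nat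
  assumes a: "a \<ge> 1" and b: "b \<ge> 2" and irr: "log b a \<notin> \<rat>"
    and t: "t > 0" "[a = 1] (mod t)" "[b = 1] (mod t)"
    and P: "\<And>x. x \<in> P \<Longrightarrow> real a * x \<in> P" "\<And>x n. x \<in> P \<Longrightarrow> x + of_int n \<in> P"
    and perfect: "\<And>x e. x \<in> P \<Longrightarrow> e > 0 \<Longrightarrow> \<exists>y\<in>P. y \<noteq> x \<and> \<bar>y - x\<bar> < e"
    and Z: "\<And>y. y \<in> Z \<Longrightarrow> real b * y \<in> Z" "\<And>y n. y \<in> Z \<Longrightarrow> y + of_int n \<in> Z" "closed Z"
    and gap: "Z \<inter> {c..<c + 1 / real t} = {}"
    and U: "open U" "U \<inter> P \<subseteq> Z"
    and rec: "\<And>V. open V \<Longrightarrow> V \<subseteq> U \<Longrightarrow> V \<inter> P \<noteq> {} \<Longrightarrow> recurrent a P V"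
  shows "U \<inter> P = {}"
proof (rule ccontr)
  assume "U \<inter> P \<noteq> {}"
  then obtain x where x: "x \<in> U \<inter> P" by blast
  have "c \<notin> Z"
    using gap t(1) by auto
  hence "Z \<noteq> UNIV" by blast
  then obtain w where w: "\<And>i. i \<le> t \<Longrightarrow> (x, w + real i / real t) \<in> closure (orbit_graph b P)"
    using progression_in_fibres[OF a b irr t P perfect Z _ U rec x, of t] by blast
  \<comment> \<open>This is the least integer with \<open>w + K/t \<ge> c\<close>; its remainder
    modulo \<open>t\<close> selects the term of the progression.\<close>
  define K where "K = \<lceil>t * (c - w)\<rceil>"
  have K1: "t * (c - w) \<le> K" "K < t * (c - w) + 1"
    unfolding K_def by linarith+
  have "t * (c - w) / t \<le> K / t"
    by (intro divide_right_mono K1) auto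
  moreover have "K / t < (t * (c - w) + 1) / t"
    using t(1) by (intro divide_strict_right_mono K1) auto
  ultimately have K: "w + K / t \<in> {c..<c + 1 / real t}"
    using t(1) by (simp add: add_divide_distrib)
  have i: "nat (K mod t) \<le> t"
    using t(1) by (simp add: nat_le_iff less_imp_le)
  have "w + real (nat (K mod t)) / real t \<in> Z"
    using closure_orbit_graph_fibre[OF Z U _ w[OF i]] x by blast
  hence "w + real (nat (K mod t)) / real t + of_int (K div t) \<in> Z"
    by (rule Z(2))
  moreover have "real_of_int K = real t * of_int (K div t) + of_int (K mod t)"
    by (metis mult_div_mod_eq of_int_add of_int_mult of_int_of_nat_eq)
  hence "w + K / t = w + real (nat (K mod t)) / real t + of_int (K div t)"
    using t(1) by (simp add: field_simps)
  ultimately show False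
    using K gap by auto
qed

section \<open>Invariant measures\<close>

lemma log_irrational:
  assumes "a \<ge> 2" "b \<ge> 2" "mult_independent a b"
  shows "log b a \<notin> \<rat>"
proof
  assume rat: "log b a \<in> \<rat>"
  have pos: "log b a > 0"
    using assms by simp
  obtain m n :: nat where mn: "n \<noteq> 0" "\<bar>log b a\<bar> = m / n"
    using Rats_abs_nat_div_natE[OF rat] by metis
  hence eq: "n * log b a = m"
    using pos by (simp add: field_simps)
  have "m > 0"
    using mn pos by (intro Nat.gr0I) auto
  have "log b (real a ^ n) = m"
    using eq assms by (simp add: log_nat_power)
  moreover have "real b powr log b (real a ^ n) = real a ^ n"
    using assms by (intro powr_log_cancel) auto
  ultimately have "real a ^ n = real b ^ m"
    using assms by (simp add: powr_realpow)
  hence "a ^ n = b ^ m"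
    by (metis of_nat_eq_iff of_nat_power)
  thus False
    using assms(3) mn(1) \<open>m > 0\<close> unfolding mult_independent_def by auto
qed

lemma mult_independent_powers:
  assumes "mult_independent a b" "p > 0"
  shows "mult_independent (a ^ p) (b ^ p)"
  using assms unfolding mult_independent_def by (simp flip: power_mult)

section \<open>Periodic lifts of subsets of the unit interval\<close>

definition periodization :: "real set \<Rightarrow> real set" where
  "periodization S = {x + of_int n | x n. x \<in> S}"

lemma periodizationI: "x \<in> S \<Longrightarrow> x + of_int n \<in> periodization S"
  unfolding periodization_def by blast

lemma subset_periodization: "S \<subseteq> periodization S"
  using periodizationI[of _ S 0] by auto

lemma periodization_shift: "x \<in> periodization S \<Longrightarrow> x + of_int n \<in> periodization S"
  unfolding periodization_def by (clarsimp, metis add.assoc of_int_add)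

lemma periodization_power_mult:
  assumes "times_map a ` S \<subseteq> S" "x \<in> periodization S"
  shows "real (a ^ p) * x \<in> periodization S"
proof -
  have *: "real a * x \<in> periodization S" if x: "x \<in> periodization S" for x
  proof -
    obtain y n where y: "y \<in> S" "x = y + of_int n"
      using x unfolding periodization_def by blast
    have "real a * x = times_map a y + of_int (\<lfloor>real a * y\<rfloor> + int a * n)"
      by (simp add: y(2) times_map_def frac_def algebra_simps)
    thus ?thesis
      using periodizationI assms(1) y(1) by (metis image_subset_iff)
  qed
  show ?thesis
    by (induction p) (use * assms(2) in \<open>auto simp: mult.assoc\<close>)
qed

lemma closed_periodization:
  assumes "compact S"
  shows "closed (periodization S)"
proof -
  have "periodization S = (\<Union>x\<in>S. \<Union>y\<in>\<int>. {x + y})"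
    by (auto simp: periodization_def elim!: Ints_cases)
  thus ?thesis
    using compact_closed_sums[OF assms closed_Ints] by simp
qed

text \<open>The endpoints are excluded because the lift identifies them: 0 in \<open>S\<close> puts
  1 into \<open>periodization S\<close>.\<close>

lemma periodization_Int_unit:
  assumes "S \<subseteq> {0..1}" "x \<in> periodization S" "x \<in> {0<..<1}"
  shows "x \<in> S"
proof -
  obtain y n where y: "y \<in> S" "x = y + of_int n"
    using assms(2) unfolding periodization_def by blast
  have "y \<in> {0..1}"
    using assms(1) y(1) by blast
  hence "of_int n < (1::real)" "of_int n > (-1::real)"
    using assms(3) y(2) by auto
  hence "n = 0"
    by linarith
  thus ?thesis
    using y by simp
qed

lemma times_map_funpow: "\<exists>n::int. (times_map a ^^ k) x = real a ^ k * x + n"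
proof (induction k)
  case 0
  show ?case
    by (intro exI[of _ 0]) simp
next
  case (Suc k)
  then obtain n :: int where n: "(times_map a ^^ k) x = real a ^ k * x + n"
    by blast
  have "(times_map a ^^ Suc k) x = times_map a (real a ^ k * x + n)"
    by (simp add: n)
  also have "\<dots> = real a ^ Suc k * x + of_int (int a * n - \<lfloor>real a * (real a ^ k * x + n)\<rfloor>)"
    by (simp add: times_map_def frac_def distrib_left mult.assoc)
  finally show ?case by blast
qed

section \<open>Return frequencies and the support\<close>

lemma measurable_funpow:
  assumes "T \<in> measurable M M"
  shows "(T ^^ k) \<in> measurable M M"
proof (induction k)
  case (Suc k)
  show ?case
    unfolding funpow.simps by (rule measurable_comp[OF Suc assms])
qed (simp add: id_def)

lemma distr_funpow:
  assumes "T \<in> measurable M M" "distr M M T = M"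
  shows "distr M M (T ^^ k) = M"
proof (induction k)
  case (Suc k)
  have "distr M M (T ^^ Suc k) = distr (distr M M (T ^^ k)) M T"
    unfolding funpow.simps by (rule distr_distr[OF assms(1) measurable_funpow[OF assms(1)], symmetric])
  also have "\<dots> = M"
    unfolding Suc.IH by (rule assms(2))
  finally show ?case .
qed (simp add: id_def distr_id)

text \<open>By invariance the expected number of visits before time \<open>N\<close> is
  \<open>prob E * N\<close>. If almost every point stayed strictly below this value, so would the
  expectation.\<close>

lemma (in prob_space) exists_many_returns:
  assumes T: "T \<in> measurable M M" "distr M M T = M" and E: "E \<in> events" and X: "AE x in M. x \<in> X"
  shows "\<exists>x\<in>X. prob E * real N \<le> real (card {k. k < N \<and> (T ^^ k) x \<in> E})"
proof (rule ccontr)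
  assume contr: "\<not> ?thesis"
  have f_card: "(\<Sum>k<N. indicator E ((T ^^ k) x)) = real (card {k. k < N \<and> (T ^^ k) x \<in> E})" for x
  proof -
    have "(\<Sum>k<N. indicator E ((T ^^ k) x)) = (\<Sum>k<N. if (T ^^ k) x \<in> E then 1 else (0::real))"
      by (rule sum.cong) (auto simp: indicator_def)
    also have "\<dots> = real (card ({..<N} \<inter> {k. (T ^^ k) x \<in> E}))"
      by (simp add: sum.If_cases)
    also have "{..<N} \<inter> {k. (T ^^ k) x \<in> E} = {k. k < N \<and> (T ^^ k) x \<in> E}"
      by auto
    finally show ?thesis .
  qed
  have meas: "(\<lambda>x. indicator E ((T ^^ k) x) :: real) \<in> borel_measurable M" for k
    using measurable_funpow[OF T(1), of k] E by measurable
  have int: "integrable M (\<lambda>x. indicator E ((T ^^ k) x) :: real)" for k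
    by (intro integrable_const_bound[of _ 1] AE_I2 meas) (simp add: indicator_def)
  have "expectation (\<lambda>x. indicator E ((T ^^ k) x)) = prob E" for k
  proof -
    have "expectation (\<lambda>x. indicator E ((T ^^ k) x)) = integral\<^sup>L (distr M M (T ^^ k)) (indicator E :: 'a \<Rightarrow> real)"
      using E by (subst integral_distr[OF measurable_funpow[OF T(1)]]) auto
    thus ?thesis
      using E by (simp add: distr_funpow[OF T])
  qed
  hence "expectation (\<lambda>x. \<Sum>k<N. indicator E ((T ^^ k) x)) = prob E * N"
    using int by (subst Bochner_Integration.integral_sum) auto
  moreover have "expectation (\<lambda>x. \<Sum>k<N. indicator E ((T ^^ k) x)) < prob E * N"
  proof (rule expectation_less)
    show "AE x in M. (\<Sum>k<N. indicator E ((T ^^ k) x)) < prob E * N"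
      using X by eventually_elim (use contr f_card in \<open>auto simp: not_le\<close>)
  qed (use int in auto)
  ultimately show False by simp
qed

text \<open>The complement of the support is covered by the null sets of a countable basis.\<close>

lemma AE_measure_support:
  fixes M :: "'a::second_countable_topology measure"
  assumes "\<And>U. open U \<Longrightarrow> U \<inter> space M \<in> sets M"
  shows "AE x in M. x \<in> measure_support M"
proof -
  obtain B :: "'a set set" where B: "countable B" "topological_basis B"
    using ex_countable_basis by blast
  define N where "N = (\<Union>b\<in>{b\<in>B. emeasure M (b \<inter> space M) = 0}. b \<inter> space M)"
  have "N \<in> null_sets M"
    unfolding N_def
  proof (rule null_sets_UN')
    show "countable {b\<in>B. emeasure M (b \<inter> space M) = 0}"
      using B(1) by auto
    fix b assume b: "b \<in> {b\<in>B. emeasure M (b \<inter> space M) = 0}"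
    thus "b \<inter> space M \<in> null_sets M"
      using assms topological_basis_open[OF B(2)] by blast
  qed
  moreover have "{x \<in> space M. x \<notin> measure_support M} \<subseteq> N"
  proof
    fix x assume x: "x \<in> {x \<in> space M. x \<notin> measure_support M}"
    then obtain U where U: "open U" "x \<in> U" "emeasure M (U \<inter> space M) = 0"
      unfolding measure_support_def by (auto simp: not_gr_zero)
    obtain b where b: "b \<in> B" "x \<in> b" "b \<subseteq> U"
      using topological_basisE[OF B(2) U(1,2)] by blast
    have "emeasure M (b \<inter> space M) \<le> emeasure M (U \<inter> space M)"
      using b(3) assms U(1) by (intro emeasure_mono) auto
    thus "x \<in> N"
      using U(3) b x unfolding N_def by auto
  qed
  ultimately show ?thesis
    by (rule AE_I')
qed

text \<open>If \<open>U\<close> met the support only in \<open>x\<close>, it would be null, as both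
  \<open>{x}\<close> and the complement of the support are.\<close>

lemma measure_support_perfect:
  fixes M :: "'a::{second_countable_topology, t1_space} measure"
  assumes sets: "\<And>U. open U \<Longrightarrow> U \<inter> space M \<in> sets M" and "nonatomic M"
    and x: "x \<in> measure_support M" and U: "open U" "x \<in> U"
  shows "\<exists>y\<in>measure_support M. y \<in> U \<and> y \<noteq> x"
proof (rule ccontr)
  assume contr: "\<not> ?thesis"
  have xM: "x \<in> space M"
    using x by (auto simp: measure_support_def)
  have "space M - (- {x}) \<inter> space M \<in> sets M"
    using sets[of "- {x}"] by auto
  moreover have "space M - (- {x}) \<inter> space M = {x}"
    using xM by auto
  ultimately have "{x} \<in> null_sets M"
    using \<open>nonatomic M\<close> xM by (auto simp: nonatomic_def)
  hence "AE y in M. y \<notin> {x}"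
    by (rule AE_not_in)
  moreover have "AE y in M. y \<in> measure_support M"
    by (rule AE_measure_support) (rule sets)
  ultimately have "AE y in M. y \<notin> U \<inter> space M"
    by eventually_elim (use contr in auto)
  hence "emeasure M (U \<inter> space M) = 0"
    using AE_iff_measurable[OF sets[OF U(1)], of "\<lambda>y. y \<notin> U \<inter> space M"] by auto
  thus False
    using x U by (auto simp: measure_support_def)
qed

text \<open>As \<open>V\<close> meets the support, its measure is positive and serves as the
  frequency. Iterates of \<open>times_map\<close> differ from multiplication by powers only by
  integers, which \<open>return_times\<close> allows.\<close>

lemma recurrent_periodization:
  fixes a p :: nat and X V :: "real set"
  assumes \<mu>: "borel_prob_unit \<mu>" "invariant_measure (times_map a) \<mu>" "measure_support \<mu> = X"
    and X: "times_map a ` X \<subseteq> X" and V: "open V" "V \<subseteq> {0<..<1}" "V \<inter> periodization X \<noteq> {}"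
  shows "recurrent (a ^ p) (periodization X) V"
proof -
  interpret prob_space \<mu>
    using \<mu>(1) by (simp add: borel_prob_unit_def)
  have sets: "sets \<mu> = sets unit_borel"
    using \<mu>(1) by (simp add: borel_prob_unit_def)
  have space: "space \<mu> = {0..1}"
    using sets_eq_imp_space_eq[OF sets] by (simp add: space_restrict_space)
  have open_sets: "U \<inter> space \<mu> \<in> sets \<mu>" if "open U" for U
    unfolding sets space sets_restrict_space using that by auto
  have X01: "X \<subseteq> {0..1}"
    using \<mu>(3) space by (auto simp: measure_support_def)
  have V_space: "V \<inter> space \<mu> = V"
    using V(2) space by auto
  have VE: "V \<in> events"
    using open_sets[OF V(1)] V_space by simp
  obtain v where v: "v \<in> V" "v \<in> periodization X"
    using V(3) by blast
  have "v \<in> X"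
    using periodization_Int_unit[OF X01 v(2)] v(1) V(2) by blast
  hence "emeasure \<mu> (V \<inter> space \<mu>) > 0"
    using \<mu>(3) V(1) v(1) by (auto simp: measure_support_def)
  hence prob_V: "prob V > 0"
    unfolding V_space by (simp add: emeasure_eq_measure)
  define T where "T = times_map a ^^ p"
  have Tm: "times_map a \<in> measurable \<mu> \<mu>"
    using times_map_measurable[of a] measurable_cong_sets[OF sets sets] by blast
  have T: "T \<in> measurable \<mu> \<mu>" "distr \<mu> \<mu> T = \<mu>"
    using measurable_funpow[OF Tm] distr_funpow[OF Tm] \<mu>(2) by (auto simp: T_def invariant_measure_def)
  have T_pow: "\<exists>n::int. (T ^^ k) x = real (a ^ p) ^ k * x + n" for k x
    using times_map_funpow[where a=a and k="p * k" and x=x] by (simp add: T_def funpow_mult power_mult)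
  have TX: "(T ^^ k) x \<in> X" if "x \<in> X" for k x
  proof -
    have "(times_map a ^^ j) x \<in> X" for j
      by (induction j) (use X that in auto)
    thus ?thesis
      by (simp add: T_def funpow_mult)
  qed
  have AE_X: "AE x in \<mu>. x \<in> X"
    unfolding \<mu>(3)[symmetric] by (rule AE_measure_support) (rule open_sets)
  show ?thesis
    unfolding recurrent_def
  proof (intro exI[of _ "prob V"] conjI allI prob_V)
    fix N :: nat
    obtain x where x: "x \<in> X" "prob V * real N \<le> real (card {k. k < N \<and> (T ^^ k) x \<in> V})"
      using exists_many_returns[OF T VE AE_X, of N] by blast
    show "\<exists>x\<in>V \<inter> periodization X. prob V * real N \<le> real (card ({..<N} \<inter> return_times (a ^ p) V x))"
    proof (cases "N = 0")
      case True
      thus ?thesis using v by (intro bexI[of _ v]) simp_all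
    next
      case False
      define K where "K = {k. k < N \<and> (T ^^ k) x \<in> V}"
      have "card K > 0"
        using x(2) mult_pos_pos[OF prob_V, of "real N"] False unfolding K_def by simp
      hence "K \<noteq> {}" "finite K"
        by (auto simp: card_gt_0_iff)
      \<comment> \<open>the first visit to \<open>V\<close> serves as new starting point, since \<open>x\<close> need not lie in \<open>V\<close>\<close>
      define j where "j = Min K"
      have j: "j \<in> K" "\<And>k. k \<in> K \<Longrightarrow> j \<le> k"
        using \<open>K \<noteq> {}\<close> \<open>finite K\<close> by (auto simp: j_def)
      define y where "y = (T ^^ j) x"
      \<comment> \<open>Since \<open>j\<close> is the first visit, subtracting it turns every visit
        of \<open>x\<close> into a return of \<open>y\<close> before time \<open>N\<close>.\<close>
      have "(\<lambda>k. k - j) ` K \<subseteq> {..<N} \<inter> return_times (a ^ p) V y"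
      proof clarify
        fix k assume k: "k \<in> K"
        have "(T ^^ k) x = (T ^^ (k - j)) y"
          using j(2)[OF k] by (simp add: y_def flip: funpow_add[unfolded o_def, THEN fun_cong])
        moreover obtain n :: int where "(T ^^ (k - j)) y = real (a ^ p) ^ (k - j) * y + n"
          using T_pow by blast
        moreover have "(T ^^ k) x \<in> V"
          using k by (simp add: K_def)
        ultimately have "k - j \<in> return_times (a ^ p) V y"
          unfolding return_times_def by auto
        thus "k - j \<in> {..<N} \<inter> return_times (a ^ p) V y"
          using k by (auto simp: K_def)
      qed
      moreover have "inj_on (\<lambda>k. k - j) K"
        using j(2) by (auto simp: inj_on_def) (metis le_add_diff_inverse2)
      ultimately have "card K \<le> card ({..<N} \<inter> return_times (a ^ p) V y)"
        by (intro card_inj_on_le) auto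
      moreover have "y \<in> V \<inter> periodization X"
        using j(1) TX[OF x(1)] subset_periodization by (auto simp: y_def K_def)
      ultimately show ?thesis
        using x(2) unfolding K_def by (intro bexI[of _ y]) auto
    qed
  qed
qed

section \<open>Choice of the modulus and passage to the lifts\<close>

theorem corollary1p5:
  fixes a b :: nat and X Y :: "real set"
  assumes "a \<ge> 2" and "b \<ge> 2" and "mult_independent a b"
    and "closed X" and "X \<subseteq> {0..1}" and "times_map a ` X \<subseteq> X"
    and "\<exists>\<mu>. borel_prob_unit \<mu> \<and> nonatomic \<mu> \<and> invariant_measure (times_map a) \<mu>
              \<and> measure_support \<mu> = X"
    and "closed Y" and "Y \<subset> {0..1}" and "times_map b ` Y \<subseteq> Y"
  shows "(top_of_set X) interior_of (X \<inter> Y) = {}"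
proof (rule ccontr)
  assume "(top_of_set X) interior_of (X \<inter> Y) \<noteq> {}"
  then obtain x0 where "x0 \<in> (top_of_set X) interior_of (X \<inter> Y)"
    by blast
  then obtain T where T: "openin (top_of_set X) T" "x0 \<in> T" "T \<subseteq> X \<inter> Y"
    unfolding interior_of_def by blast
  then obtain V0 where V0: "open V0" "X \<inter> V0 \<subseteq> Y" "x0 \<in> X \<inter> V0"
    unfolding openin_open by blast
  obtain \<mu> where \<mu>: "borel_prob_unit \<mu>" "nonatomic \<mu>" "invariant_measure (times_map a) \<mu>"
      "measure_support \<mu> = X"
    using assms(7) by blast
  have sets: "sets \<mu> = sets unit_borel"
    using \<mu>(1) by (simp add: borel_prob_unit_def)
  have open_sets: "U \<inter> space \<mu> \<in> sets \<mu>" if "open U" for U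
    using that unfolding sets sets_eq_imp_space_eq[OF sets] sets_restrict_space
    by (auto simp: space_restrict_space)
  have X_perfect: "\<exists>y\<in>X. y \<in> U \<and> y \<noteq> x" if "x \<in> X" "open U" "x \<in> U" for x U
    using measure_support_perfect[of \<mu> x U] open_sets \<mu>(2) that unfolding \<mu>(4) by blast

  obtain u where u: "u \<in> {0..1}" "u \<notin> Y"
    using assms(9) by blast
  \<comment> \<open>A closed \<open>Y\<close> containing the open interval would also contain its
    endpoints, so the gap can be found away from 0 and 1.\<close>
  have "{0..1} \<subseteq> Y" if "{0<..<1} \<subseteq> Y"
    using closure_minimal[OF that assms(8)] by simp
  then obtain u' where u': "u' \<in> {0<..<1}" "u' \<notin> Y"
    using u by blast
  have "open ({0<..<1} - Y)"
    using assms(8) by (intro open_Diff) auto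
  then obtain r where r: "r > 0" "ball u' r \<subseteq> {0<..<1} - Y"
    using u' by (meson DiffI open_contains_ball)
  obtain m :: nat where m: "1 / Suc m < r"
    using r(1) nat_approx_posE by blast
  \<comment> \<open>\<open>t\<close> is coprime to \<open>a\<close> and \<open>b\<close>, so suitable powers of them fix \<open>1/t\<close> modulo 1\<close>
  define t where "t = a * b * m + 1"
  have ab: "a * b \<ge> 1"
    using assms(1,2) by (simp add: Suc_le_eq)
  \<comment> \<open>Besides coprimality, the size of \<open>t\<close> matters: an interval of length
    \<open>1/t\<close> must fit into the gap.\<close>
  have "Suc m \<le> t"
    using mult_le_mono1[OF ab, of m] by (simp add: t_def)
  hence "1 / real t \<le> 1 / Suc m"
    by (intro divide_left_mono) auto
  hence t_small: "1 / real t < r"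
    using m by linarith
  have cop: "coprime d t" if "d dvd a * b" for d
  proof (rule coprimeI)
    fix c assume c: "c dvd d" "c dvd t"
    have "c dvd a * b * m"
      using c(1) that by (meson dvd_mult2 dvd_trans)
    thus "c dvd 1"
      using c(2) unfolding t_def by (simp only: dvd_add_right_iff)
  qed
  define p where "p = totient t"
  have p: "p > 0" "[a ^ p = 1] (mod t)" "[b ^ p = 1] (mod t)"
    using euler_theorem[OF cop[of a]] euler_theorem[OF cop[of b]] by (simp_all add: p_def t_def)

  define P Z where "P = periodization X" and "Z = periodization Y"
  define U where "U = V0 \<inter> {0<..<1}"
  have "U \<inter> P = {}"
  proof (rule no_common_open_part)
    show "1 \<le> a ^ p" "2 \<le> b ^ p"
      using assms(1,2) p(1) self_le_power[of b p] by auto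
    show "log (b ^ p) (a ^ p) \<notin> \<rat>"
      using assms(1-3) p(1) self_le_power[of b p] self_le_power[of a p]
      by (intro log_irrational mult_independent_powers) auto
    show "t > 0" "[a ^ p = 1] (mod t)" "[b ^ p = 1] (mod t)"
      using p by (auto simp: t_def)
    show "\<And>x. x \<in> P \<Longrightarrow> real (a ^ p) * x \<in> P" "\<And>y. y \<in> Z \<Longrightarrow> real (b ^ p) * y \<in> Z"
      unfolding P_def Z_def using assms(6,10) by (blast intro: periodization_power_mult)+
    show "\<And>x n. x \<in> P \<Longrightarrow> x + of_int n \<in> P" "\<And>y n. y \<in> Z \<Longrightarrow> y + of_int n \<in> Z"
      unfolding P_def Z_def by (simp_all add: periodization_shift)
    show "closed Z"
      unfolding Z_def using assms(8,9)
      by (intro closed_periodization) (meson bounded_closed_interval bounded_subset compact_eq_bounded_closed psubset_imp_subset)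
    show "open U"
      using V0(1) by (auto simp: U_def)
    show "U \<inter> P \<subseteq> Z"
      using periodization_Int_unit[OF assms(5)] V0(2) subset_periodization[of Y]
      unfolding U_def P_def Z_def by blast
    show "\<exists>y\<in>P. y \<noteq> x \<and> \<bar>y - x\<bar> < e" if x: "x \<in> P" and e: "e > 0" for x e
    proof -
      obtain z n where z: "z \<in> X" "x = z + of_int n"
        using x unfolding P_def periodization_def by blast
      obtain y where y: "y \<in> X" "y \<in> ball z e" "y \<noteq> z"
        using X_perfect[OF z(1), of "ball z e"] e by auto
      thus ?thesis
        using z(2) periodizationI[OF y(1), of n]
        by (intro bexI[of _ "y + of_int n"]) (auto simp: P_def dist_real_def abs_minus_commute)
    qed
    show "Z \<inter> {u'..<u' + 1 / real t} = {}"
    proof (rule ccontr)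
      assume "Z \<inter> {u'..<u' + 1 / real t} \<noteq> {}"
      then obtain y where y: "y \<in> Z" "y \<in> {u'..<u' + 1 / real t}"
        by blast
      hence "y \<in> ball u' r"
        using t_small by (auto simp: dist_real_def)
      hence "y \<in> {0<..<1}" "y \<notin> Y"
        using r(2) by blast+
      thus False
        using periodization_Int_unit[of Y y] y(1) assms(9) unfolding Z_def by blast
    qed
    show "recurrent (a ^ p) P V" if "open V" "V \<subseteq> U" "V \<inter> P \<noteq> {}" for V
      using that unfolding P_def U_def
      by (intro recurrent_periodization[OF \<mu>(1,3,4) assms(6)]) auto
  qed
  moreover have "\<exists>y\<in>X. y \<in> U"
  proof (cases "x0 \<in> {0<..<1}")
    case True
    thus ?thesis
      using V0(3) by (auto simp: U_def)
  next
    case False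
    \<comment> \<open>Here \<open>x0\<close> is an endpoint. Radius 1 excludes the opposite
      endpoint, so a further point of \<open>X\<close> in this ball lies in the open
      interval.\<close>
    obtain y where y: "y \<in> X" "y \<in> V0 \<inter> ball x0 1" "y \<noteq> x0"
      using X_perfect[of x0 "V0 \<inter> ball x0 1"] V0 by auto
    have "x0 \<in> {0..1}" "y \<in> {0..1}"
      using assms(5) V0(3) y(1) by auto
    hence "y \<in> {0<..<1}"
      using y(2,3) False by (auto simp: dist_real_def)
    thus ?thesis
      using y by (auto simp: U_def)
  qed
  ultimately show False
    using subset_periodization[of X] unfolding P_def by blast
qed

end
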